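(* Let $q=4$. The infinite-volume Gibbs measure $p$ on $q$-colorings of the infinite $3$-regular tree $\widehat{T}^2$ has strong spatial mixing with rate $\delta(d)=C\exp(-ad)$ for some positive constants $C$ and $a$.
   Context: $\widehat{T}^2$ is the infinite tree in which every vertex has degree $3$. Write $[q]=\{1,\ldots,q\}$. A $q$-coloring of a graph $G=(V,E)$ is a function $\sigma:V\to[q]$ with $\sigma(u)\ne\sigma(v)$ for every $\{u,v\}\in E$. A probability measure $p$ on the set of $q$-colorings of an infinite graph $G$ is an infinite-volume Gibbs measure if for every finite region $R\subseteq V$ and any $q$-coloring $\sigma$ of $G$, the conditional probability distribution $p(\cdot\mid\sigma(V\setminus R))$ is the uniform distribution on $q$-colorings of $R$ (compatible with the coloring $\sigma$ of $V\setminus R$). At least one such measure always exists; the claim is about any such $p$, with absolute constants $C,a$. For $U\subseteq V$, $\sigma_U$ denotes the restriction to $U$ of a $q$-coloring $\sigma$ of $G$. For $v\notin U$, $p_v^{\sigma_U}\in\mathbb{R}^q$ is the marginal distribution of the color of $v$ under $p$ conditioned on the coloring of $U$ being $\sigma_U$. (If this event has $p$-probability zero, the conditioned measure is understood as a probability measure on $q$-colorings agreeing with $\sigma_U$ on $U$ whose conditional distribution on each finite $R\subseteq V\setminus U$, given the colors outside $R$, is uniform on the compatible $q$-colorings of $R$.) $\mathrm{dist}(u,v)$ is graph distance and $\mathrm{dist}(v,W)=\min_{u\in W}\mathrm{dist}(v,u)$. Definition (strong spatial mixing). Let $\delta:\mathbb{N}\to\mathbb{R}^+$. The infinite-volume Gibbs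 measure $p$ on $q$-colorings of $G=(V,E)$ has strong spatial mixing with rate $\delta(\cdot)$ if and only if for every $U\subseteq V$, every vertex $v\in V\setminus U$, and every pair of $q$-colorings $\sigma_U,\phi_U$ of $U$ (restrictions of $q$-colorings of $G$), $|p_v^{\sigma_U}-p_v^{\phi_U}|\le\delta(\mathrm{dist}(v,\Delta))$, where $\Delta\subseteq U$ is the (nonempty) set of vertices on which $\sigma_U$ and $\phi_U$ differ, and $|\cdot|$ is a fixed norm on $\mathbb{R}^q$ (the choice only affects the constant $C$). *)

theory Defs
  imports "HOL-Probability.Probability"
begin

text \<open>A graph is given by a vertex set \<open>V\<close> and a set \<open>E\<close> of two-element subsets of \<open>V\<close>.\<close>

definition simple_graph :: "'v set \<Rightarrow> 'v set set \<Rightarrow> bool" where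
  "simple_graph V E \<longleftrightarrow> (\<forall>e\<in>E. \<exists>u\<in>V. \<exists>v\<in>V. u \<noteq> v \<and> e = {u, v})"

definition adj_rel :: "'v set set \<Rightarrow> ('v \<times> 'v) set" where
  "adj_rel E = {(u, v). {u, v} \<in> E}"

definition connected_graph :: "'v set \<Rightarrow> 'v set set \<Rightarrow> bool" where
  "connected_graph V E \<longleftrightarrow> (\<forall>u\<in>V. \<forall>v\<in>V. (u, v) \<in> (adj_rel E)\<^sup>*)"

definition is_cycle :: "'v set set \<Rightarrow> 'v list \<Rightarrow> bool" where
  "is_cycle E xs \<longleftrightarrow> length xs \<ge> 3 \<and> distinct xs \<and>
     (\<forall>i. Suc i < length xs \<longrightarrow> {xs ! i, xs ! Suc i} \<in> E) \<and> {last xs, hd xs} \<in> E"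

definition tree :: "'v set \<Rightarrow> 'v set set \<Rightarrow> bool" where
  "tree V E \<longleftrightarrow> simple_graph V E \<and> V \<noteq> {} \<and> connected_graph V E \<and> (\<nexists>xs. is_cycle E xs)"

definition degree :: "'v set set \<Rightarrow> 'v \<Rightarrow> nat" where
  "degree E v = card {u. {v, u} \<in> E}"

text \<open>For \<open>k \<ge> 2\<close> this determines the graph up to isomorphism.  As \<open>card\<close> is 0 on infinite sets,
  it is locally finite for \<open>k > 0\<close>, hence \<open>V\<close> is countable.\<close>

definition infinite_regular_tree :: "nat \<Rightarrow> 'v set \<Rightarrow> 'v set set \<Rightarrow> bool" where
  "infinite_regular_tree k V E \<longleftrightarrow> tree V E \<and> infinite V \<and> (\<forall>v\<in>V. degree E v = k)"

definition graph_dist :: "'v set set \<Rightarrow> 'v \<Rightarrow> 'v \<Rightarrow> nat" where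
  "graph_dist E u v = (LEAST n. (u, v) \<in> adj_rel E ^^ n)"

text \<open>On \<open>nat\<close> the infimum of a nonempty set is its minimum, also when the set is infinite.\<close>

definition graph_dist_set :: "'v set set \<Rightarrow> 'v \<Rightarrow> 'v set \<Rightarrow> nat" where
  "graph_dist_set E v W = (INF u\<in>W. graph_dist E v u)"

text \<open>Colorings are extensional functions on \<open>V\<close>, so that they are points of the product
  space below.\<close>

definition colorings :: "nat \<Rightarrow> 'v set \<Rightarrow> 'v set set \<Rightarrow> ('v \<Rightarrow> nat) set" where
  "colorings q V E = {\<sigma> \<in> V \<rightarrow>\<^sub>E {1..q}. \<forall>u v. {u, v} \<in> E \<longrightarrow> \<sigma> u \<noteq> \<sigma> v}"

definition compatible_colorings ::
  "nat \<Rightarrow> 'v set \<Rightarrow> 'v set set \<Rightarrow> 'v set \<Rightarrow> ('v \<Rightarrow> nat) \<Rightarrow> ('v \<Rightarrow> nat) set" where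
  "compatible_colorings q V E R \<sigma> =
     {\<xi> \<in> R \<rightarrow>\<^sub>E {1..q}. override_on \<sigma> \<xi> R \<in> colorings q V E}"

definition coloring_space :: "nat \<Rightarrow> 'v set \<Rightarrow> 'v set set \<Rightarrow> ('v \<Rightarrow> nat) measure" where
  "coloring_space q V E =
     restrict_space (\<Pi>\<^sub>M v\<in>V. count_space {1..q}) (colorings q V E)"

text \<open>The sub-sigma-algebra of \<open>\<mu>\<close> generated by the colors of the vertices in \<open>W\<close>.\<close>

definition color_algebra ::
  "nat \<Rightarrow> ('v \<Rightarrow> nat) measure \<Rightarrow> 'v set \<Rightarrow> ('v \<Rightarrow> nat) measure" where
  "color_algebra q \<mu> W =
     vimage_algebra (space \<mu>) (\<lambda>\<tau>. restrict \<tau> W) (\<Pi>\<^sub>M v\<in>W. count_space {1..q})"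

lemma space_coloring_space: "space (coloring_space q V E) = colorings q V E"
  by (auto simp: coloring_space_def space_restrict_space space_PiM colorings_def)

lemma subalgebra_color_algebra:
  assumes "sets \<mu> = sets (coloring_space q V E)" "W \<subseteq> V"
  shows "subalgebra \<mu> (color_algebra q \<mu> W)"
proof -
  let ?N = "\<Pi>\<^sub>M v\<in>W. count_space {1..q}"
  have "(\<lambda>\<tau>. restrict \<tau> W) \<in> measurable (coloring_space q V E) ?N"
    unfolding coloring_space_def
    by (rule measurable_restrict_space1, rule measurable_restrict_subset) (rule assms(2))
  then have "(\<lambda>\<tau>. restrict \<tau> W) \<in> measurable \<mu> ?N"
    using measurable_cong_sets[OF assms(1) refl] by blast
  then have "sets (color_algebra q \<mu> W) \<subseteq> sets \<mu>"
    unfolding color_algebra_def by (intro sets_image_in_sets) simp_all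
  then show ?thesis
    by (simp add: subalgebra_def color_algebra_def)
qed

text \<open>The conditional distribution on \<open>R\<close> given the colors outside \<open>R\<close> is expressed through
  conditional expectations of indicators.  These are determined up to null sets only, hence the
  almost-everywhere quantifier: the uniform distributions are a version of the
  conditional distribution.\<close>

definition uniform_given_outside ::
  "nat \<Rightarrow> 'v set \<Rightarrow> 'v set set \<Rightarrow> ('v \<Rightarrow> nat) measure \<Rightarrow> 'v set \<Rightarrow> bool" where
  "uniform_given_outside q V E \<mu> R \<longleftrightarrow>
     (\<forall>\<xi> \<in> R \<rightarrow>\<^sub>E {1..q}. AE \<sigma> in \<mu>.
        real_cond_exp \<mu> (color_algebra q \<mu> (V - R))
          (indicator {\<tau> \<in> space \<mu>. restrict \<tau> R = \<xi>}) \<sigma>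
        = pmf (pmf_of_set (compatible_colorings q V E R \<sigma>)) \<xi>)"

definition coloring_measure ::
  "nat \<Rightarrow> 'v set \<Rightarrow> 'v set set \<Rightarrow> ('v \<Rightarrow> nat) measure \<Rightarrow> bool" where
  "coloring_measure q V E \<mu> \<longleftrightarrow> prob_space \<mu> \<and> sets \<mu> = sets (coloring_space q V E)"

definition infinite_volume_gibbs ::
  "nat \<Rightarrow> 'v set \<Rightarrow> 'v set set \<Rightarrow> ('v \<Rightarrow> nat) measure \<Rightarrow> bool" where
  "infinite_volume_gibbs q V E p \<longleftrightarrow>
     coloring_measure q V E p \<and> (\<forall>R. finite R \<and> R \<subseteq> V \<longrightarrow> uniform_given_outside q V E p R)"

text \<open>The measures \<open>\<mu>\<close> that qualify as \<open>p\<close> conditioned on the coloring of \<open>U\<close> being the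
  restriction of \<open>\<sigma>\<close> to \<open>U\<close>.  Only the values of \<open>\<sigma>\<close> on \<open>U\<close> matter.  If the event is not null,
  \<open>\<mu>\<close> is the elementary conditional probability measure.\<close>

definition is_conditioned ::
  "nat \<Rightarrow> 'v set \<Rightarrow> 'v set set \<Rightarrow> ('v \<Rightarrow> nat) measure \<Rightarrow> 'v set \<Rightarrow> ('v \<Rightarrow> nat) \<Rightarrow>
     ('v \<Rightarrow> nat) measure \<Rightarrow> bool" where
  "is_conditioned q V E p U \<sigma> \<mu> \<longleftrightarrow>
     (let A = {\<tau> \<in> space p. \<forall>u\<in>U. \<tau> u = \<sigma> u} in
      if measure p A > 0 then \<mu> = uniform_measure p A
      else coloring_measure q V E \<mu> \<and> (AE \<tau> in \<mu>. \<forall>u\<in>U. \<tau> u = \<sigma> u) \<and>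
        (\<forall>R. finite R \<and> R \<subseteq> V - U \<longrightarrow> uniform_given_outside q V E \<mu> R))"

definition marginal :: "('v \<Rightarrow> nat) measure \<Rightarrow> 'v \<Rightarrow> nat \<Rightarrow> real" where
  "marginal \<mu> v c = measure \<mu> {\<tau> \<in> space \<mu>. \<tau> v = c}"

text \<open>Vectors in \<open>\<real>\<^sup>q\<close> are functions on \<open>{1..q}\<close>, with the 1-norm.  In the null case
  the bound is required of every measure that qualifies as a conditioned measure.\<close>

definition strong_spatial_mixing ::
  "nat \<Rightarrow> 'v set \<Rightarrow> 'v set set \<Rightarrow> ('v \<Rightarrow> nat) measure \<Rightarrow> (nat \<Rightarrow> real) \<Rightarrow> bool" where
  "strong_spatial_mixing q V E p \<delta> \<longleftrightarrow>
     (\<forall>U \<sigma> \<phi> v \<mu> \<nu>.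
        U \<subseteq> V \<and> v \<in> V - U \<and> \<sigma> \<in> colorings q V E \<and> \<phi> \<in> colorings q V E \<and>
        {u \<in> U. \<sigma> u \<noteq> \<phi> u} \<noteq> {} \<and>
        is_conditioned q V E p U \<sigma> \<mu> \<and> is_conditioned q V E p U \<phi> \<nu> \<longrightarrow>
        (\<Sum>c\<in>{1..q}. \<bar>marginal \<mu> v c - marginal \<nu> v c\<bar>)
          \<le> \<delta> (graph_dist_set E v {u \<in> U. \<sigma> u \<noteq> \<phi> u}))"

end

theory Submission
  imports Defs
begin

text \<open>
  Cut the tree at the distance \<open>d\<close> from \<open>v\<close> to the set of disagreements.  Conditioned on the colors
  outside the ball, the marginal at \<open>v\<close> is computed by the usual recursion: a free vertex with
  children \<open>x\<close>, \<open>y\<close> sends the message \<open>p c \<propto> (1 - x c) * (1 - y c)\<close>.  Two boundary conditions that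
  agree on the pinned vertices inside the ball give two families of messages.  Their discrepancy
  is measured by the oscillation of \<open>ln (1 - p' c) - ln (1 - p c)\<close> over the colors; one step of the
  recursion multiplies the sum of the oscillations of the children by at most the Dobrushin
  coefficient \<open>max p c / (1 - p c')\<close> of the new message.

  Call a vertex live if its two messages differ.  A live vertex has a live child, hence its messages
  are far from degenerate.  The coefficient is at most \<open>2/3\<close> if there is one live child, and smaller
  than \<open>1/2\<close> if there are two which in turn have two live children each.  Weighting
  the vertices with one and with two live children by \<open>7/10\<close> and \<open>1\<close> turns this into
  exponential decay.
\<close>

text \<open>Four colors leave almost no room on this tree: two live children contract only if the
  coefficient is below 1/2, and the bound obtained for messages whose own children include just one
  live vertex is 3/5. Such a vertex compensates by having received one oscillation instead of two:
  the factor 2/3 replaces twice 1/2. If all grandchildren involved are live, the children satisfy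
  the extremal inequalities below, and the coefficient falls below 1/2 by about 1/6000. That margin
  is the reason for a rate \<open>\<kappa>\<close> so close to 1.

  Pinned vertices inside the ball send messages concentrated on one color, for which
  \<open>ln (1 - p c)\<close> is meaningless. They are never live, as both boundary conditions pin
  them alike, so they enter only as an equal pair with log ratio 0.

  The root has three children and falls outside the two-child recursion; there a Lipschitz estimate
  is enough. The passage to measures needs no uniqueness of the conditioned measure: whatever the
  colors outside a finite region, the conditional law at the root is a message, and averages of
  messages close to a fixed number stay close to it.\<close>

declare One_nat_def [simp del]

subsection \<open>Bilinear inequalities\<close>

text \<open>In the following lemmas \<open>z\<close> and \<open>w\<close> are the color distributions at the two children.  The
  multipliers, found by linear programming, express the difference of both sides as a nonnegative
  combination of products of the constraints.\<close>

lemma off_diagonal_bound: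
  fixes z0 z1 z2 z3 w0 w1 w2 w3 :: real
  assumes nonneg: "z0 \<ge> 0" "z1 \<ge> 0" "z2 \<ge> 0" "z3 \<ge> 0" "w0 \<ge> 0" "w1 \<ge> 0" "w2 \<ge> 0" "w3 \<ge> 0"
    and wle: "w0 \<le> 1/2" "w1 \<le> 1/2" "w2 \<le> 1/2" "w3 \<le> 1/2"
    and sums: "z0 + z1 + z2 + z3 = 1" "w0 + w1 + w2 + w3 = 1"
  shows "(1 - z0) * (1 - w0) + (1 - z1) * (1 - w1) + (1 - z2) * (1 - w2) + (1 - z3) * (1 - w3) \<le> 11 * ((1 - z0) * (1 - w0)) + 5 * ((1 - z3) * (1 - w3))"
proof -
  have z3: "z3 = 1 - z0 - z1 - z2" and w3: "w3 = 1 - w0 - w1 - w2"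
    using sums by auto
  have "0 \<le> z0 * w1
      + z0 * w2
      + 2 * (z0 * (1 - 2 * w3))
      + 3 * (z1 * w0)
      + 13 * (z1 * w1)
      + 14 * (z1 * w2)
      + 9 * (z1 * w3)
      + 3 * (z2 * w0)
      + 14 * (z2 * w1)
      + 13 * (z2 * w2)
      + 9 * (z2 * w3)
      + 7 * (z3 * w1)
      + 7 * (z3 * w2)
      + 6 * (z3 * w3)
      + 2 * (z3 * (1 - 2 * w0))"
    using nonneg wle by (intro add_nonneg_nonneg mult_nonneg_nonneg) auto
  also have "\<dots> = (11 * ((1 - z0) * (1 - w0)) + 5 * ((1 - z3) * (1 - w3)) - ((1 - z0) * (1 - w0) + (1 - z1) * (1 - w1) + (1 - z2) * (1 - w2) + (1 - z3) * (1 - w3)))"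
    unfolding z3 w3 by (simp add: algebra_simps)
  finally show ?thesis by simp
qed

text \<open>After clearing the common denominator of \<open>combine z w\<close>, this is the first
  half of \<open>balanced\<close> with constant 1/2. Equality holds for z concentrated on color 0
  and w equal to 1/2 on colors 2 and 3, so the constant is best possible.\<close>

lemma balanced_single_lower:
  fixes z0 z1 z2 z3 w0 w1 w2 w3 :: real
  assumes nonneg: "z0 \<ge> 0" "z1 \<ge> 0" "z2 \<ge> 0" "z3 \<ge> 0" "w0 \<ge> 0" "w1 \<ge> 0" "w2 \<ge> 0" "w3 \<ge> 0"
    and wle: "w0 \<le> 1/2" "w1 \<le> 1/2" "w2 \<le> 1/2" "w3 \<le> 1/2"
    and sums: "z0 + z1 + z2 + z3 = 1" "w0 + w1 + w2 + w3 = 1"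
  shows "1 * ((1 - z1) * (1 - w1) + (1 - z2) * (1 - w2) + (1 - z3) * (1 - w3)) \<le> 2 * ((1 - z0) * (1 - w0) + (1 - z2) * (1 - w2) + (1 - z3) * (1 - w3))"
proof -
  have z3: "z3 = 1 - z0 - z1 - z2" and w3: "w3 = 1 - w0 - w1 - w2"
    using sums by auto
  have "0 \<le> z0 * w0
      + 2 * (z0 * w1)
      + 2 * (z1 * w0)
      + 4 * (z1 * w1)
      + 3 * (z1 * w2)
      + 3 * (z1 * w3)
      + 3 * (z2 * w1)
      + 2 * (z2 * w2)
      + z2 * w3
      + 3 * (z3 * w1)
      + z3 * w2
      + 2 * (z3 * w3)"
    using nonneg wle by (intro add_nonneg_nonneg mult_nonneg_nonneg) auto
  also have "\<dots> = (2 * ((1 - z0) * (1 - w0) + (1 - z2) * (1 - w2) + (1 - z3) * (1 - w3)) - (1 * ((1 - z1) * (1 - w1) + (1 - z2) * (1 - w2) + (1 - z3) * (1 - w3))))"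
    unfolding z3 w3 by (simp add: algebra_simps)
  finally show ?thesis by simp
qed

text \<open>The second half of \<open>balanced\<close>. After cancelling common terms it is
  \<open>off_diagonal_bound\<close>, hence the same multipliers. Equality holds for z concentrated
  on color 0 and w equal to 1/2 on colors 0 and 3.\<close>

lemma balanced_single_sum:
  fixes z0 z1 z2 z3 w0 w1 w2 w3 :: real
  assumes nonneg: "z0 \<ge> 0" "z1 \<ge> 0" "z2 \<ge> 0" "z3 \<ge> 0" "w0 \<ge> 0" "w1 \<ge> 0" "w2 \<ge> 0" "w3 \<ge> 0"
    and wle: "w0 \<le> 1/2" "w1 \<le> 1/2" "w2 \<le> 1/2" "w3 \<le> 1/2"
    and sums: "z0 + z1 + z2 + z3 = 1" "w0 + w1 + w2 + w3 = 1"
  shows "6 * ((1 - z1) * (1 - w1) + (1 - z2) * (1 - w2) + (1 - z3) * (1 - w3)) \<le> 5 * (((1 - z0) * (1 - w0) + (1 - z2) * (1 - w2) + (1 - z3) * (1 - w3)) + ((1 - z0) * (1 - w0) + (1 - z1) * (1 - w1) + (1 - z3) * (1 - w3)))"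
proof -
  have z3: "z3 = 1 - z0 - z1 - z2" and w3: "w3 = 1 - w0 - w1 - w2"
    using sums by auto
  have "0 \<le> z0 * w1
      + z0 * w2
      + 2 * (z0 * (1 - 2 * w3))
      + 3 * (z1 * w0)
      + 13 * (z1 * w1)
      + 14 * (z1 * w2)
      + 9 * (z1 * w3)
      + 3 * (z2 * w0)
      + 14 * (z2 * w1)
      + 13 * (z2 * w2)
      + 9 * (z2 * w3)
      + 7 * (z3 * w1)
      + 7 * (z3 * w2)
      + 6 * (z3 * w3)
      + 2 * (z3 * (1 - 2 * w0))"
    using nonneg wle by (intro add_nonneg_nonneg mult_nonneg_nonneg) auto
  also have "\<dots> = (5 * (((1 - z0) * (1 - w0) + (1 - z2) * (1 - w2) + (1 - z3) * (1 - w3)) + ((1 - z0) * (1 - w0) + (1 - z1) * (1 - w1) + (1 - z3) * (1 - w3))) - (6 * ((1 - z1) * (1 - w1) + (1 - z2) * (1 - w2) + (1 - z3) * (1 - w3))))"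
    unfolding z3 w3 by (simp add: algebra_simps)
  finally show ?thesis by simp
qed

text \<open>The ratio comes from the extremal point z = (5/11, 0, 5/11, 1/11), w = (5/11, 0, 1/11,
  5/11), where the sums on the left and on the right are 241/121 and 156/121.\<close>

lemma balanced_double_lower:
  fixes z0 z1 z2 z3 w0 w1 w2 w3 :: real
  assumes nonneg: "z0 \<ge> 0" "z1 \<ge> 0" "z2 \<ge> 0" "z3 \<ge> 0" "w0 \<ge> 0" "w1 \<ge> 0" "w2 \<ge> 0" "w3 \<ge> 0"
    and zle: "z0 \<le> 5/11" "z1 \<le> 5/11" "z2 \<le> 5/11" "z3 \<le> 5/11"
    and wle: "w0 \<le> 5/11" "w1 \<le> 5/11" "w2 \<le> 5/11" "w3 \<le> 5/11"
    and sums: "z0 + z1 + z2 + z3 = 1" "w0 + w1 + w2 + w3 = 1"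
  shows "156 * ((1 - z1) * (1 - w1) + (1 - z2) * (1 - w2) + (1 - z3) * (1 - w3)) \<le> 241 * ((1 - z0) * (1 - w0) + (1 - z2) * (1 - w2) + (1 - z3) * (1 - w3))"
proof -
  have z3: "z3 = 1 - z0 - z1 - z2" and w3: "w3 = 1 - w0 - w1 - w2"
    using sums by auto
  have "0 \<le> 14190 * (z0 * w1)
      + 426 * (z0 * (5 - 11 * w0))
      + 16320 * (z1 * w0)
      + 45481 * (z1 * w1)
      + 31291 * (z1 * w2)
      + 31291 * (z1 * w3)
      + 33066 * (z2 * w1)
      + 1361 * (z2 * (5 - 11 * w0))
      + 33066 * (z3 * w1)
      + 1361 * (z3 * (5 - 11 * w0))
      + 1716 * ((5 - 11 * z0) * w2)
      + 1716 * ((5 - 11 * z0) * w3)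
      + 85 * ((5 - 11 * z2) * (5 - 11 * w2))
      + 85 * ((5 - 11 * z3) * (5 - 11 * w3))"
    using nonneg zle wle by (intro add_nonneg_nonneg mult_nonneg_nonneg) auto
  also have "\<dots> = 121 * (241 * ((1 - z0) * (1 - w0) + (1 - z2) * (1 - w2) + (1 - z3) * (1 - w3)) - (156 * ((1 - z1) * (1 - w1) + (1 - z2) * (1 - w2) + (1 - z3) * (1 - w3))))"
    unfolding z3 w3 by (simp add: algebra_simps)
  finally show ?thesis by simp
qed

text \<open>The ratio comes from the extremal point z = w = (5/11, 1/11, 0, 5/11), where the sum on
  the left is 257/121 and the two on the right add up to 365/121.\<close>

lemma balanced_double_sum:
  fixes z0 z1 z2 z3 w0 w1 w2 w3 :: real
  assumes nonneg: "z0 \<ge> 0" "z1 \<ge> 0" "z2 \<ge> 0" "z3 \<ge> 0" "w0 \<ge> 0" "w1 \<ge> 0" "w2 \<ge> 0" "w3 \<ge> 0"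
    and zle: "z0 \<le> 5/11" "z1 \<le> 5/11" "z2 \<le> 5/11" "z3 \<le> 5/11"
    and wle: "w0 \<le> 5/11" "w1 \<le> 5/11" "w2 \<le> 5/11" "w3 \<le> 5/11"
    and sums: "z0 + z1 + z2 + z3 = 1" "w0 + w1 + w2 + w3 = 1"
  shows "365 * ((1 - z1) * (1 - w1) + (1 - z2) * (1 - w2) + (1 - z3) * (1 - w3)) \<le> 257 * (((1 - z0) * (1 - w0) + (1 - z2) * (1 - w2) + (1 - z3) * (1 - w3)) + ((1 - z0) * (1 - w0) + (1 - z1) * (1 - w1) + (1 - z3) * (1 - w3)))"
proof -
  have z3: "z3 = 1 - z0 - z1 - z2" and w3: "w3 = 1 - w0 - w1 - w2"
    using sums by auto
  have "0 \<le> 1933 * (z0 * (5 - 11 * w3))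
      + 5940 * (z1 * w2)
      + 4665 * (z1 * (5 - 11 * w0))
      + 205 * (z1 * (5 - 11 * w3))
      + 5940 * (z2 * w1)
      + 4665 * (z2 * (5 - 11 * w0))
      + 205 * (z2 * (5 - 11 * w3))
      + 3231 * (z3 * (5 - 11 * w0))
      + 3870 * ((5 - 11 * z0) * w0)
      + 1235 * ((5 - 11 * z0) * w1)
      + 1235 * ((5 - 11 * z0) * w2)
      + 47 * ((5 - 11 * z0) * w3)
      + 1974 * ((5 - 11 * z3) * w0)"
    using nonneg zle wle by (intro add_nonneg_nonneg mult_nonneg_nonneg) auto
  also have "\<dots> = 55 * (257 * (((1 - z0) * (1 - w0) + (1 - z2) * (1 - w2) + (1 - z3) * (1 - w3)) + ((1 - z0) * (1 - w0) + (1 - z1) * (1 - w1) + (1 - z3) * (1 - w3))) - (365 * ((1 - z1) * (1 - w1) + (1 - z2) * (1 - w2) + (1 - z3) * (1 - w3))))"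
    unfolding z3 w3 by (simp add: algebra_simps)
  finally show ?thesis by simp
qed

subsection \<open>Messages on four colors\<close>

definition distribution :: "(nat \<Rightarrow> real) \<Rightarrow> bool" where
  "distribution p \<longleftrightarrow> (\<forall>c\<in>{1..4}. 0 \<le> p c) \<and> (\<Sum>c\<in>{1..4}. p c) = 1"

text \<open>An enumeration of the colors in arbitrary order, through which the inequalities in eight
  real variables apply with any color in any position.\<close>

definition color_quad :: "nat \<Rightarrow> nat \<Rightarrow> nat \<Rightarrow> nat \<Rightarrow> bool" where
  "color_quad c k l a \<longleftrightarrow> distinct [c, k, l, a] \<and> {c, k, l, a} = {1..4}"

text \<open>The distribution of the color of a vertex with two children \<open>x\<close> and \<open>y\<close> in its subtree.\<close>

definition combine :: "(nat \<Rightarrow> real) \<Rightarrow> (nat \<Rightarrow> real) \<Rightarrow> nat \<Rightarrow> real" where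
  "combine x y c = (1 - x c) * (1 - y c) / (\<Sum>k\<in>{1..4}. (1 - x k) * (1 - y k))"

lemma sum_color_quad:
  assumes "color_quad c k l a"
  shows "(\<Sum>j\<in>{1..4}. f j) = f c + f k + f l + (f a :: real)"
proof -
  have eq: "{1..4} = {c, k, l, a}" and "distinct [c, k, l, a]"
    using assms by (auto simp: color_quad_def)
  then show ?thesis unfolding eq by simp
qed

lemma color_quad_in:
  assumes "color_quad c k l a"
  shows "c \<in> {1..4}" "k \<in> {1..4}" "l \<in> {1..4}" "a \<in> {1..4}"
  using assms by (auto simp: color_quad_def)

lemma color_quad_exists:
  assumes "c \<in> {1..4::nat}" "k \<in> {1..4}" "c \<noteq> k"
  obtains l a where "color_quad c k l a"
proof -
  have "card ({1..4} - {c, k}) = 2"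
    using assms by (subst card_Diff_subset) auto
  then obtain l a where la: "{1..4} - {c, k} = {l, a}" "l \<noteq> a"
    by (meson card_2_iff)
  have "{c, k, l, a} = {1..4}"
    using la(1) assms by blast
  moreover have "l \<notin> {c, k}" "a \<notin> {c, k}"
    using la(1) by blast+
  ultimately have "color_quad c k l a"
    using la(2) assms(3) by (auto simp: color_quad_def)
  then show ?thesis by (rule that)
qed

lemma color_quad_swap:
  assumes "color_quad c k l a"
  shows "color_quad k c l a"
  using assms by (auto simp: color_quad_def)

lemma distribution_nonneg: "distribution p \<Longrightarrow> c \<in> {1..4} \<Longrightarrow> 0 \<le> p c"
  by (simp add: distribution_def)

lemma distribution_le_one:
  assumes "distribution p" "c \<in> {1..4}"
  shows "p c \<le> 1"
  using assms member_le_sum[of c "{1..4}" p] by (auto simp: distribution_def)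

lemma distribution_sum_quad:
  assumes "distribution p" "color_quad c k l a"
  shows "p c + p k + p l + p a = 1"
  using assms sum_color_quad[OF assms(2), of p] by (simp add: distribution_def)

lemma combine_commute: "combine x y = combine y x"
  by (simp add: combine_def fun_eq_iff mult.commute)

text \<open>The 2 is 4 - 1 - 1. It keeps the denominator away from zero even for pinned children and
  yields the bound 1/2 of \<open>combine_le_half\<close>.\<close>

lemma combine_denominator_eq:
  assumes "distribution x" "distribution y"
  shows "(\<Sum>k\<in>{1..4}. (1 - x k) * (1 - y k)) = 2 + (\<Sum>k\<in>{1..4}. x k * y k)"
proof -
  have "(\<Sum>k\<in>{1..4}. (1 - x k) * (1 - y k)) = (\<Sum>k\<in>{1..4}. 1 - x k - y k + x k * y k)"
    by (simp add: algebra_simps)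
  then show ?thesis
    using assms by (simp add: sum.distrib sum_subtractf distribution_def)
qed

lemma combine_denominator:
  assumes "distribution x" "distribution y"
  shows "2 \<le> (\<Sum>k\<in>{1..4}. (1 - x k) * (1 - y k))"
proof -
  have "0 \<le> (\<Sum>k\<in>{1..4}. x k * y k)"
    using assms by (intro sum_nonneg mult_nonneg_nonneg) (auto simp: distribution_def)
  then show ?thesis by (simp add: combine_denominator_eq[OF assms])
qed

lemma distribution_combine:
  assumes "distribution x" "distribution y"
  shows "distribution (combine x y)"
  using assms combine_denominator[OF assms]
  by (auto simp: distribution_def combine_def distribution_le_one simp flip: sum_divide_distrib)

text \<open>A bound on the total variation distance of \<open>p\<close> conditioned on not being \<open>c\<close> and
  on not being \<open>c'\<close>.\<close>

definition contraction_bound :: "real \<Rightarrow> (nat \<Rightarrow> real) \<Rightarrow> bool" where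
  "contraction_bound \<rho> p \<longleftrightarrow> (\<forall>c\<in>{1..4}. \<forall>c'\<in>{1..4}. c \<noteq> c' \<longrightarrow> p c \<le> \<rho> * (1 - p c'))"

text \<open>The recursion multiplies the factors \<open>1 - p c\<close>, so in these coordinates the
  contributions of the children add up, and differences between colors do not see the normalization.
  For \<open>p = p'\<close> the value is 0 also where \<open>p c = 1\<close>.\<close>

definition log_ratio :: "(nat \<Rightarrow> real) \<Rightarrow> (nat \<Rightarrow> real) \<Rightarrow> nat \<Rightarrow> real" where
  "log_ratio p p' c = ln (1 - p' c) - ln (1 - p c)"

definition oscillation_le :: "real \<Rightarrow> (nat \<Rightarrow> real) \<Rightarrow> bool" where
  "oscillation_le D h \<longleftrightarrow> (\<forall>c\<in>{1..4}. \<forall>c'\<in>{1..4}. h c - h c' \<le> D)"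

section \<open>Contraction of the oscillation in one step of the recursion\<close>

lemma exp_weighted_le:
  fixes b t :: real
  assumes "0 \<le> b" "b \<le> 1"
  shows "exp (b * t) \<le> 1 - b + b * exp t"
  using convex_onD[OF exp_convex assms, of 0 t] by simp

text \<open>The derivative of \<open>ln (b * exp t + s)\<close> in t is
  \<open>b * exp t / (b * exp t + s)\<close>, which increases with t, so its value at the right
  endpoint bounds the increment. Convexity of exp, applied from t back to 0, gives this without
  differentiation.\<close>

lemma ln_mixture_le:
  fixes b s t \<rho> :: real
  assumes "0 \<le> b" "0 < s" "0 \<le> t" and bound: "b * exp t \<le> \<rho> * (b * exp t + s)"
  shows "ln (b * exp t + s) - ln (b + s) \<le> \<rho> * t"
proof -
  define X where "X = b * exp t + s"
  define \<beta> where "\<beta> = b * exp t / X"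
  have X: "X > 0" using assms by (simp add: X_def add_nonneg_pos)
  have "\<beta> \<le> \<rho>" using bound X by (simp add: \<beta>_def X_def field_simps)
  have \<beta>: "0 \<le> \<beta>" "\<beta> \<le> 1"
    using assms X by (auto simp: \<beta>_def X_def)
  have "exp (\<beta> * (- t)) \<le> 1 - \<beta> + \<beta> * exp (- t)"
    by (rule exp_weighted_le[OF \<beta>])
  also have "\<dots> = (X - b * exp t + b * (exp t * exp (- t))) / X"
    using X by (simp add: \<beta>_def field_simps)
  also have "\<dots> = (b + s) / X"
    by (simp add: X_def exp_minus_inverse)
  finally have "ln (exp (\<beta> * (- t))) \<le> ln ((b + s) / X)"
    by (subst ln_le_cancel_iff) (use assms X in \<open>auto simp: add_nonneg_pos\<close>)
  then have "- (\<beta> * t) \<le> ln (b + s) - ln X"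
    using assms X by (simp add: ln_div add_nonneg_pos)
  moreover have "\<beta> * t \<le> \<rho> * t"
    using \<open>\<beta> \<le> \<rho>\<close> assms by (simp add: mult_right_mono)
  ultimately show ?thesis by (simp add: X_def)
qed

text \<open>For negative t the previous lemma is run from \<open>b * exp t\<close> back to
  \<open>b\<close>; hence the slope is bounded at both ends. The clipped forms allow the two colors
  of a difference to be estimated separately.\<close>

lemma ln_mixture_bounds:
  fixes b s t \<rho> :: real
  assumes "0 \<le> b" "0 < s" "0 \<le> \<rho>"
    and "b \<le> \<rho> * (b + s)" "b * exp t \<le> \<rho> * (b * exp t + s)"
  shows "ln (b * exp t + s) - ln (b + s) \<le> \<rho> * max t 0"
    and "\<rho> * min t 0 \<le> ln (b * exp t + s) - ln (b + s)"
proof -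
  have up: "0 \<le> ln (b * exp t + s) - ln (b + s)" if "0 \<le> t"
    using that assms by (simp add: ln_mono add_nonneg_pos mult_le_cancel_left1)
  have down: "ln (b * exp t + s) - ln (b + s) \<le> 0" if "t \<le> 0"
    using that assms by (simp add: ln_mono add_nonneg_pos mult_le_cancel_left2)
  show "ln (b * exp t + s) - ln (b + s) \<le> \<rho> * max t 0"
    using ln_mixture_le[OF assms(1,2) _ assms(5)] down by (cases "t \<ge> 0") (auto simp: max_def)
  have "ln (b * exp t * exp (- t) + s) - ln (b * exp t + s) \<le> \<rho> * (- t)" if "t \<le> 0"
    by (rule ln_mixture_le) (use that assms in \<open>auto simp flip: exp_add simp: mult.assoc\<close>)
  then show "\<rho> * min t 0 \<le> ln (b * exp t + s) - ln (b + s)"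
    using up by (cases "t \<le> 0") (auto simp: min_def mult.assoc simp flip: exp_add)
qed

text \<open>No interpolation between the two messages is needed: as \<open>\<lambda>t. ln (b * exp t + s)\<close> is convex, its
  slope between two points is bounded by its slope at the endpoints.\<close>

lemma oscillation_contraction:
  assumes w: "\<And>k. k \<in> {1..4} \<Longrightarrow> 0 \<le> w k" "0 < (\<Sum>k\<in>{1..4}. w k)"
    and w': "\<And>k. k \<in> {1..4} \<Longrightarrow> w' k = w k * exp (h k)"
    and p: "\<And>k. p k = w k / (\<Sum>k\<in>{1..4}. w k)" and p': "\<And>k. p' k = w' k / (\<Sum>k\<in>{1..4}. w' k)"
    and h: "oscillation_le D h" and \<rho>: "0 \<le> \<rho>" "\<rho> < 1"
    and r: "contraction_bound \<rho> p" "contraction_bound \<rho> p'"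
  shows "oscillation_le (\<rho> * D) (log_ratio p p')"
  unfolding oscillation_le_def
proof (intro ballI)
  fix c d :: nat assume cd: "c \<in> {1..4}" "d \<in> {1..4}"
  define S S' where "S = (\<Sum>k\<in>{1..4}. w k)" and "S' = (\<Sum>k\<in>{1..4}. w' k)"
  have S: "S > 0" using w by (simp add: S_def)
  have w'0: "0 \<le> w' k" if "k \<in> {1..4}" for k using w w' that by simp
  obtain k0 where k0: "k0 \<in> {1..4}" "w k0 \<noteq> 0"
    using w(2) by (metis less_irrefl sum.neutral)
  then have "0 < w' k0" using w w' by (simp add: less_le)
  then have S': "S' > 0" unfolding S'_def
    using k0 w'0 by (intro sum_pos2[of _ k0]) auto
  show "log_ratio p p' c - log_ratio p p' d \<le> \<rho> * D"
  proof (cases "c = d")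
    case True
    have "0 \<le> D" using h cd unfolding oscillation_le_def by fastforce
    then show ?thesis using True \<rho> by simp
  next
    case False
    then obtain k l where q: "color_quad c d k l"
      using color_quad_exists cd by metis
    note q_in = color_quad_in[OF q]
    have Sq: "S = w c + w d + w k + w l" and Sq': "S' = w' c + w' d + w' k + w' l"
      using sum_color_quad[OF q] by (auto simp: S_def S'_def)
    \<comment> \<open>\<open>1 - p c\<close> and \<open>1 - p d\<close> share the weight
      \<open>s\<close> of the other two colors and the normalizer \<open>S\<close>, which cancels in
      their ratio.\<close>
    define s s' where "s = w k + w l" and "s' = w' k + w' l"
    have one_minus: "1 - p c = (w d + s) / S" "1 - p d = (w c + s) / S"
      "1 - p' c = (w' d + s') / S'" "1 - p' d = (w' c + s') / S'"
      using S S' by (auto simp: p p' S_def[symmetric] S'_def[symmetric] s_def s'_def Sq Sq' field_simps)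
    have "p d \<le> \<rho> * (1 - p c)" "p c \<le> \<rho> * (1 - p d)"
      using r(1) cd False by (auto simp: contraction_bound_def)
    then have "w d / S \<le> \<rho> * ((w d + s) / S)" "w c / S \<le> \<rho> * ((w c + s) / S)"
      unfolding one_minus(1,2) by (simp_all only: p S_def)
    then have rb: "w d \<le> \<rho> * (w d + s)" "w c \<le> \<rho> * (w c + s)"
      using S by (auto simp: divide_le_cancel)
    have "p' d \<le> \<rho> * (1 - p' c)" "p' c \<le> \<rho> * (1 - p' d)"
      using r(2) cd False by (auto simp: contraction_bound_def)
    then have "w' d / S' \<le> \<rho> * ((w' d + s') / S')" "w' c / S' \<le> \<rho> * ((w' c + s') / S')"
      unfolding one_minus(3,4) by (simp_all only: p' S'_def)
    then have rb': "w' d \<le> \<rho> * (w' d + s')" "w' c \<le> \<rho> * (w' c + s')"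
      using S' by (auto simp: divide_le_cancel)
    \<comment> \<open>If \<open>c\<close> and \<open>d\<close> carried all the weight, conditioning
      on not being \<open>c\<close> would force \<open>d\<close>, which \<open>\<rho> < 1\<close>
      excludes.\<close>
    have "s \<noteq> 0"
    proof
      assume "s = 0"
      then have "(1 - \<rho>) * w d \<le> 0" "(1 - \<rho>) * w c \<le> 0" using rb by (auto simp: algebra_simps)
      then have "w d \<le> 0" "w c \<le> 0" using \<rho> by (auto simp: mult_le_0_iff)
      then show False using S \<open>s = 0\<close> by (simp add: Sq s_def)
    qed
    then have s: "s > 0" using w q_in by (simp add: s_def less_le)
    obtain lo where lo: "\<And>j. j \<in> {1..4} \<Longrightarrow> lo \<le> h j" "\<And>j. j \<in> {1..4} \<Longrightarrow> h j \<le> lo + D"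
    proof
      have "Min (h ` {1..4}) \<in> h ` {1..4}" by (intro Min_in) auto
      then obtain i where i: "i \<in> {1..4}" "Min (h ` {1..4}) = h i" by blast
      show "Min (h ` {1..4}) \<le> h j" if "j \<in> {1..4}" for j
        using that by (intro Min_le) auto
      show "h j \<le> Min (h ` {1..4}) + D" if "j \<in> {1..4}" for j
        using that i h by (auto simp: oscillation_le_def algebra_simps)
    qed
    have s'_bounds: "s * exp lo \<le> s'" "s' \<le> s * exp (lo + D)"
      using lo w w' q_in by (auto simp: s_def s'_def distrib_right intro!: add_mono mult_left_mono)
    then have "s' > 0" using s by (meson exp_gt_zero less_le_trans mult_pos_pos)
    \<comment> \<open>The joint shift of the two remaining colors: \<open>exp u\<close> is a
      weighted mean of \<open>exp (h k)\<close> and \<open>exp (h l)\<close>, so \<open>u\<close>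
      lies in the range of \<open>h\<close>. Pulling out \<open>exp u\<close> leaves a single moving
      weight in each logarithm.\<close>
    define u where "u = ln (s' / s)"
    have "exp u = s' / s" using s \<open>s' > 0\<close> by (simp add: u_def)
    then have u1: "s' = s * exp u" using s by simp
    have u: "s' = s * exp u" "lo \<le> u" "u \<le> lo + D"
      using s'_bounds s unfolding u1 by simp_all
    have split: "ln (w' j + s') = u + ln (w j * exp (h j - u) + s)" if "j \<in> {1..4}" for j
    proof -
      have "w' j + s' = exp u * (w j * exp (h j - u) + s)"
        using w' that u by (simp add: algebra_simps exp_diff)
      moreover have "w j * exp (h j - u) + s > 0"
        using s w that by (simp add: add_nonneg_pos)
      ultimately show ?thesis by (simp add: ln_mult)
    qed
    have tilt: "w j * exp (h j - u) \<le> \<rho> * (w j * exp (h j - u) + s)"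
      if "j \<in> {1..4}" "w' j \<le> \<rho> * (w' j + s')" for j
    proof -
      have "exp u * (w j * exp (h j - u)) \<le> exp u * (\<rho> * (w j * exp (h j - u) + s))"
        using that w' u by (simp add: algebra_simps exp_diff)
      then show ?thesis by simp
    qed
    have D: "ln (w' d + s') - ln (w d + s) \<le> u + \<rho> * max (h d - u) 0"
      using ln_mixture_bounds(1)[OF w(1)[OF cd(2)] s \<rho>(1) rb(1) tilt[OF cd(2) rb'(1)]] split[OF cd(2)]
      by simp
    have C: "u + \<rho> * min (h c - u) 0 \<le> ln (w' c + s') - ln (w c + s)"
      using ln_mixture_bounds(2)[OF w(1)[OF cd(1)] s \<rho>(1) rb(2) tilt[OF cd(1) rb'(2)]] split[OF cd(1)]
      by simp
    have pos: "w c + s > 0" "w d + s > 0" "w' c + s' > 0" "w' d + s' > 0"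
      using w(1) w'0 cd s \<open>s' > 0\<close> by (auto simp: add_nonneg_pos)
    then have "log_ratio p p' c - log_ratio p p' d
        = (ln (w' d + s') - ln (w d + s)) - (ln (w' c + s') - ln (w c + s))"
      using pos S S' one_minus by (simp add: log_ratio_def ln_div)
    also have "\<dots> \<le> \<rho> * (max (h d - u) 0 - min (h c - u) 0)"
      using C D by (simp add: algebra_simps)
    \<comment> \<open>\<open>h c\<close>, \<open>h d\<close> and \<open>u\<close> lie in one
      interval of length \<open>D\<close>.\<close>
    also have "\<dots> \<le> \<rho> * D"
      using lo[OF cd(1)] lo[OF cd(2)] u \<rho> by (intro mult_left_mono) auto
    finally show ?thesis .
  qed
qed

text \<open>The information about a child that \<open>contraction_bound_double\<close> uses. The
  second condition is not implied by the first, since \<open>s\<close> will exceed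
  \<open>2 * lo\<close>.\<close>

definition balanced :: "real \<Rightarrow> real \<Rightarrow> (nat \<Rightarrow> real) \<Rightarrow> bool" where
  "balanced lo s p \<longleftrightarrow> (\<forall>c k l a. color_quad c k l a \<longrightarrow>
     lo * (1 - p c) \<le> 1 - p k \<and> s * (1 - p c) \<le> (1 - p k) + (1 - p l))"

lemma combine_one_minus:
  assumes "distribution x" "distribution y" "color_quad c k l a"
  shows "1 - combine x y c = ((1 - x k) * (1 - y k) + (1 - x l) * (1 - y l) + (1 - x a) * (1 - y a))
    / (\<Sum>k\<in>{1..4}. (1 - x k) * (1 - y k))"
  using combine_denominator[OF assms(1,2)] sum_color_quad[OF assms(3), of "\<lambda>k. (1 - x k) * (1 - y k)"]
  by (simp add: combine_def field_simps)

lemma scaled_divide_le: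
  fixes S q :: real
  assumes "0 < S" "0 < q" "r * A \<le> q * B"
  shows "r / q * (A / S) \<le> B / S"
  using assms by (simp add: field_simps)

lemma combine_le_half:
  assumes "distribution x" "distribution y" "c \<in> {1..4}"
  shows "combine x y c \<le> 1/2"
proof -
  have "(1 - x c) * (1 - y c) \<le> 1 * 1"
    using assms distribution_nonneg distribution_le_one by (intro mult_mono) auto
  then show ?thesis
    using combine_denominator[OF assms(1,2)] by (simp add: combine_def field_simps)
qed

text \<open>A quantitative form of nondegeneracy: if one color has probability 0, every other color
  has at least 1/11. Here \<open>x\<close> is the live child, while \<open>z\<close> may be
  concentrated on one color.\<close>

lemma combine_off_diagonal:
  assumes "distribution z" "distribution x" "\<And>c. c \<in> {1..4} \<Longrightarrow> x c \<le> 1/2"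
    and "c \<in> {1..4}" "a \<in> {1..4}" "c \<noteq> a"
  shows "1 \<le> 11 * combine z x c + 5 * combine z x a"
proof -
  obtain l k where q0: "color_quad c a l k"
    using color_quad_exists assms(4-6) .
  then have q: "color_quad c k l a" by (auto simp: color_quad_def)
  note q_in = color_quad_in[OF q]
  let ?S = "\<Sum>k\<in>{1..4}. (1 - z k) * (1 - x k)"
  have "?S \<le> 11 * ((1 - z c) * (1 - x c)) + 5 * ((1 - z a) * (1 - x a))"
    unfolding sum_color_quad[OF q]
    by (rule off_diagonal_bound) (use assms(1,2) q q_in assms(3)[of c] assms(3)[of k] assms(3)[of l] assms(3)[of a]
        in \<open>auto intro: distribution_nonneg distribution_sum_quad\<close>)
  moreover have "?S > 0" using combine_denominator[OF assms(1,2)] by simp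
  moreover have "11 * combine z x c + 5 * combine z x a
      = (11 * ((1 - z c) * (1 - x c)) + 5 * ((1 - z a) * (1 - x a))) / ?S"
    by (simp add: combine_def add_divide_distrib)
  ultimately show ?thesis by (simp only: le_divide_eq_1_pos)
qed

text \<open>As z has total mass 1, both sides of the claim multiplied by the denominator are linear
  in z: \<open>11 * (1 - z c) * (1 - x c)\<close> is the sum of \<open>z j * 11 * (1 - x c)\<close>
  over \<open>j \<noteq> c\<close>, and five times the denominator is the sum of
  \<open>z j * (10 + 5 * x j)\<close> over all j. The hypothesis compares the coefficients.\<close>

lemma combine_le_five_elevenths:
  assumes z: "distribution z" and x: "distribution x"
    and off: "\<And>c a. c \<in> {1..4} \<Longrightarrow> a \<in> {1..4} \<Longrightarrow> c \<noteq> a \<Longrightarrow> 1 \<le> 11 * x c + 5 * x a"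
    and c: "c \<in> {1..4}"
  shows "combine z x c \<le> 5/11"
proof -
  define d :: nat where "d = (if c = 1 then 2 else 1)"
  have d: "d \<in> {1..4}" "c \<noteq> d" by (auto simp: d_def)
  obtain k l where q: "color_quad c d k l"
    using color_quad_exists[OF c d] .
  note q_in = color_quad_in[OF q]
  let ?S = "\<Sum>k\<in>{1..4}. (1 - z k) * (1 - x k)"
  have le: "z j * (11 * (1 - x c)) \<le> z j * (10 + 5 * x j)" if "j \<in> {1..4}" "j \<noteq> c" for j
    using off[OF c that(1)] that z by (intro mult_left_mono) (auto simp: distribution_nonneg)
  have zsum: "z c + z d + z k + z l = 1"
    using distribution_sum_quad[OF z q] .
  then have "1 - z c = z d + z k + z l" by simp
  then have "11 * ((1 - z c) * (1 - x c))
      = z d * (11 * (1 - x c)) + z k * (11 * (1 - x c)) + z l * (11 * (1 - x c))"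
    by (simp only:) (simp add: algebra_simps)
  also have "\<dots> \<le> z d * (10 + 5 * x d) + z k * (10 + 5 * x k) + z l * (10 + 5 * x l)"
    using le q q_in by (intro add_mono) (auto simp: color_quad_def)
  also have "\<dots> \<le> z c * (10 + 5 * x c) + z d * (10 + 5 * x d) + z k * (10 + 5 * x k) + z l * (10 + 5 * x l)"
    using c z x by (simp add: distribution_nonneg)
  also have "\<dots> = 10 * (z c + z d + z k + z l) + 5 * (z c * x c + z d * x d + z k * x k + z l * x l)"
    by (simp add: algebra_simps)
  also have "\<dots> = 5 * ?S"
    unfolding zsum by (simp add: combine_denominator_eq[OF z x] sum_color_quad[OF q])
  finally have "11 * ((1 - z c) * (1 - x c)) \<le> 5 * ?S" .
  moreover have "?S > 0" using combine_denominator[OF z x] by simp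
  ultimately show ?thesis by (simp only: combine_def pos_divide_le_eq)
qed

lemma balanced_combine_single:
  assumes "distribution z" "distribution x" "\<And>c. c \<in> {1..4} \<Longrightarrow> x c \<le> 1/2"
  shows "balanced (1/2) (6/5) (combine z x)"
  unfolding balanced_def
proof (intro allI impI)
  fix c k l a :: nat assume q: "color_quad c k l a"
  note q_in = color_quad_in[OF q]
  let ?S = "\<Sum>k\<in>{1..4}. (1 - z k) * (1 - x k)" and ?m = "\<lambda>j. (1 - z j) * (1 - x j)"
  have S: "?S > 0" using combine_denominator[OF assms(1,2)] by simp
  note om = combine_one_minus[OF assms(1,2)]
  have eq: "1 - combine z x c = (?m k + ?m l + ?m a) / ?S"
    "1 - combine z x k = (?m c + ?m l + ?m a) / ?S" "1 - combine z x l = (?m c + ?m k + ?m a) / ?S"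
    using om[of c k l a] om[of k c l a] om[of l c k a] q by (auto simp: color_quad_def)
  have lower: "1 * (?m k + ?m l + ?m a) \<le> 2 * (?m c + ?m l + ?m a)"
    by (rule balanced_single_lower) (use assms(1,2) q q_in assms(3)[of c] assms(3)[of k] assms(3)[of l] assms(3)[of a]
        in \<open>auto intro: distribution_nonneg distribution_sum_quad\<close>)
  have sum: "6 * (?m k + ?m l + ?m a) \<le> 5 * ((?m c + ?m l + ?m a) + (?m c + ?m k + ?m a))"
    by (rule balanced_single_sum) (use assms(1,2) q q_in assms(3)[of c] assms(3)[of k] assms(3)[of l] assms(3)[of a]
        in \<open>auto intro: distribution_nonneg distribution_sum_quad\<close>)
  show "1/2 * (1 - combine z x c) \<le> 1 - combine z x k \<and>
    6/5 * (1 - combine z x c) \<le> 1 - combine z x k + (1 - combine z x l)"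
    unfolding eq add_divide_distrib[symmetric]
    by (intro conjI scaled_divide_le S lower sum) simp_all
qed

lemma balanced_combine_double:
  assumes "distribution z" "distribution x"
    and le: "\<And>c. c \<in> {1..4} \<Longrightarrow> z c \<le> 5/11" "\<And>c. c \<in> {1..4} \<Longrightarrow> x c \<le> 5/11"
  shows "balanced (156/241) (365/257) (combine z x)"
  unfolding balanced_def
proof (intro allI impI)
  fix c k l a :: nat assume q: "color_quad c k l a"
  note q_in = color_quad_in[OF q]
  let ?S = "\<Sum>k\<in>{1..4}. (1 - z k) * (1 - x k)" and ?m = "\<lambda>j. (1 - z j) * (1 - x j)"
  have S: "?S > 0" using combine_denominator[OF assms(1,2)] by simp
  note om = combine_one_minus[OF assms(1,2)]
  have eq: "1 - combine z x c = (?m k + ?m l + ?m a) / ?S"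
    "1 - combine z x k = (?m c + ?m l + ?m a) / ?S" "1 - combine z x l = (?m c + ?m k + ?m a) / ?S"
    using om[of c k l a] om[of k c l a] om[of l c k a] q by (auto simp: color_quad_def)
  have lower: "156 * (?m k + ?m l + ?m a) \<le> 241 * (?m c + ?m l + ?m a)"
    by (rule balanced_double_lower) (use assms(1,2) q q_in le[of c] le[of k] le[of l] le[of a]
        in \<open>auto intro: distribution_nonneg distribution_sum_quad\<close>)
  have sum: "365 * (?m k + ?m l + ?m a) \<le> 257 * ((?m c + ?m l + ?m a) + (?m c + ?m k + ?m a))"
    by (rule balanced_double_sum) (use assms(1,2) q q_in le[of c] le[of k] le[of l] le[of a]
        in \<open>auto intro: distribution_nonneg distribution_sum_quad\<close>)
  show "156/241 * (1 - combine z x c) \<le> 1 - combine z x k \<and>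
    365/257 * (1 - combine z x c) \<le> 1 - combine z x k + (1 - combine z x l)"
    unfolding eq add_divide_distrib[symmetric]
    by (intro conjI scaled_divide_le S lower sum) simp_all
qed

text \<open>It suffices that the factor of \<open>c\<close> is at most twice the sum of the factors
  of \<open>k\<close> and \<open>l\<close>: the bound on \<open>x\<close> costs a factor 2, and
  \<open>1 - z c\<close> is at most the sum of \<open>1 - z k\<close> and \<open>1 - z l\<close>.
  Equality occurs for z and x both equal to 1/2 on \<open>k\<close> and \<open>l\<close>.\<close>

lemma contraction_bound_single:
  assumes "distribution z" "distribution x" and le: "\<And>c. c \<in> {1..4} \<Longrightarrow> x c \<le> 1/2"
  shows "contraction_bound (2/3) (combine z x)"
  unfolding contraction_bound_def
proof (intro ballI impI)
  fix c d :: nat assume cd: "c \<in> {1..4}" "d \<in> {1..4}" "c \<noteq> d"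
  obtain k l where q: "color_quad c d k l"
    using color_quad_exists[OF cd] .
  note q_in = color_quad_in[OF q]
  let ?S = "\<Sum>k\<in>{1..4}. (1 - z k) * (1 - x k)" and ?m = "\<lambda>j. (1 - z j) * (1 - x j)"
  have S: "?S > 0" using combine_denominator[OF assms(1,2)] by simp
  have eq: "1 - combine z x d = (?m c + ?m k + ?m l) / ?S"
    using combine_one_minus[OF assms(1,2) color_quad_swap[OF q]] .
  have "(1 - z c) * (1 - x c) \<le> (1 - z c) * 1"
    using assms(1,2) cd by (intro mult_left_mono) (auto simp: distribution_nonneg distribution_le_one)
  also have "\<dots> \<le> (1 - z k) + (1 - z l)"
    using distribution_sum_quad[OF assms(1) q] assms(1) q_in distribution_nonneg[of z c] distribution_nonneg[of z d] by simp
  also have "\<dots> \<le> 2 * ((1 - z k) * (1 - x k)) + 2 * ((1 - z l) * (1 - x l))"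
    using mult_left_mono[of "1/2" "1 - x k" "1 - z k"] mult_left_mono[of "1/2" "1 - x l" "1 - z l"]
      le[of k] le[of l] distribution_le_one[OF assms(1)] q_in by simp
  finally have "?m c \<le> 2 * ?m k + 2 * ?m l" .
  moreover have "A \<le> 2 * B + 2 * C \<Longrightarrow> 3 * A \<le> 2 * (A + B + C)" for A B C :: real by simp
  ultimately have "3 * ?m c \<le> 2 * (?m c + ?m k + ?m l)" by blast
  then have "?m c \<le> 2/3 * (?m c + ?m k + ?m l)" by linarith
  then have "?m c / ?S \<le> (2/3 * (?m c + ?m k + ?m l)) / ?S"
    using S by (intro divide_right_mono) auto
  then show "combine z x c \<le> 2/3 * (1 - combine z x d)"
    unfolding eq by (simp only: combine_def times_divide_eq_right)
qed

text \<open>Expanding \<open>(1 - x k - lo * X) * (1 - y k - lo' * Y) \<ge> 0\<close> and the same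
  for \<open>l\<close>, the products at \<open>k\<close> and \<open>l\<close> together are bounded
  below by terms linear in each child. The conditions with \<open>s\<close> and \<open>s'\<close>
  then produce the factor \<open>lo * s' + lo' * s - 2 * lo * lo'\<close>.\<close>

lemma contraction_bound_double:
  assumes "distribution x" "distribution y" and bal: "balanced lo s x" "balanced lo' s' y"
    and nonneg: "0 \<le> lo" "0 \<le> lo'" and \<rho>: "0 \<le> \<rho>" "1 \<le> \<rho> * (1 + lo * s' + lo' * s - 2 * lo * lo')"
  shows "contraction_bound \<rho> (combine x y)"
  unfolding contraction_bound_def
proof (intro ballI impI)
  fix c d :: nat assume cd: "c \<in> {1..4}" "d \<in> {1..4}" "c \<noteq> d"
  obtain k l where q0: "color_quad c d k l"
    using color_quad_exists[OF cd] .
  then have q: "color_quad c k l d" by (auto simp: color_quad_def)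
  note q_in = color_quad_in[OF q]
  let ?S = "\<Sum>k\<in>{1..4}. (1 - x k) * (1 - y k)" and ?m = "\<lambda>j. (1 - x j) * (1 - y j)"
  have S: "?S > 0" using combine_denominator[OF assms(1,2)] by simp
  have eq: "1 - combine x y d = (?m c + ?m k + ?m l) / ?S"
    using combine_one_minus[OF assms(1,2) color_quad_swap[OF q0]] .
  define X Y where "X = 1 - x c" and "Y = 1 - y c"
  have XY: "0 \<le> X" "0 \<le> Y"
    using assms(1,2) cd by (auto simp: X_def Y_def distribution_le_one)
  have qs: "color_quad c l k d" using q by (auto simp: color_quad_def)
  have x: "lo * X \<le> 1 - x k" "lo * X \<le> 1 - x l" "s * X \<le> (1 - x k) + (1 - x l)"
    using bal(1) q qs unfolding balanced_def X_def by blast+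
  have y: "lo' * Y \<le> 1 - y k" "lo' * Y \<le> 1 - y l" "s' * Y \<le> (1 - y k) + (1 - y l)"
    using bal(2) q qs unfolding balanced_def Y_def by blast+
  have "0 \<le> (1 - x k - lo * X) * (1 - y k - lo' * Y)" "0 \<le> (1 - x l - lo * X) * (1 - y l - lo' * Y)"
    using x y by (auto intro!: mult_nonneg_nonneg)
  moreover have "(lo' * Y) * (s * X) \<le> (lo' * Y) * ((1 - x k) + (1 - x l))"
    "(lo * X) * (s' * Y) \<le> (lo * X) * ((1 - y k) + (1 - y l))"
    using x y XY nonneg by (auto intro!: mult_left_mono)
  ultimately have sum: "(lo * s' + lo' * s - 2 * lo * lo') * (X * Y) \<le> ?m k + ?m l"
    by (simp add: algebra_simps)
  have "?m c \<le> \<rho> * (1 + lo * s' + lo' * s - 2 * lo * lo') * (X * Y)"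
    using mult_right_mono[OF \<rho>(2), of "X * Y"] XY by (simp add: X_def Y_def)
  also have "\<dots> \<le> \<rho> * (?m c + ?m k + ?m l)"
    using mult_left_mono[OF sum \<rho>(1)] by (simp add: X_def Y_def algebra_simps)
  finally show "combine x y c \<le> \<rho> * (1 - combine x y d)"
    unfolding eq using S by (simp add: combine_def divide_right_mono)
qed

text \<open>The alternatives \<open>x = x'\<close> and \<open>y = y'\<close> admit pinned children,
  whose messages take the value 1.\<close>

lemma oscillation_combine:
  assumes dist: "distribution x" "distribution y" "distribution x'" "distribution y'"
    and x: "x = x' \<or> (\<forall>c\<in>{1..4}. x c < 1 \<and> x' c < 1)" and y: "y = y' \<or> (\<forall>c\<in>{1..4}. y c < 1 \<and> y' c < 1)"
    and osc: "oscillation_le D (log_ratio x x')" "oscillation_le D' (log_ratio y y')"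
    and \<rho>: "0 \<le> \<rho>" "\<rho> < 1"
    and r: "contraction_bound \<rho> (combine x y)" "contraction_bound \<rho> (combine x' y')"
  shows "oscillation_le (\<rho> * (D + D')) (log_ratio (combine x y) (combine x' y'))"
proof (rule oscillation_contraction[OF _ _ _ _ _ _ \<rho> r])
  show "0 \<le> (1 - x k) * (1 - y k)" if "k \<in> {1..4}" for k
    using dist that by (simp add: distribution_le_one)
  show "0 < (\<Sum>k\<in>{1..4}. (1 - x k) * (1 - y k))"
    using combine_denominator[OF dist(1,2)] by simp
  have ratio: "1 - q' k = (1 - q k) * exp (log_ratio q q' k)"
    if "q = q' \<or> (\<forall>c\<in>{1..4}. q c < 1 \<and> q' c < 1)" "k \<in> {1..4}" for q q' :: "nat \<Rightarrow> real" and k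
  proof (cases "q = q'")
    case False
    then have "q k < 1" "q' k < 1" using that by auto
    then show ?thesis by (simp add: log_ratio_def exp_diff)
  qed (simp add: log_ratio_def)
  show "(1 - x' k) * (1 - y' k) = (1 - x k) * (1 - y k) * exp (log_ratio x x' k + log_ratio y y' k)"
    if "k \<in> {1..4}" for k
    using ratio[OF x that] ratio[OF y that] by (simp add: exp_add)
  show "oscillation_le (D + D') (\<lambda>k. log_ratio x x' k + log_ratio y y' k)"
    using osc unfolding oscillation_le_def by (smt (verit))
qed (simp_all add: combine_def)

section \<open>Oscillation and differences of messages\<close>

lemma oscillation_le_mono: "oscillation_le D h \<Longrightarrow> D \<le> D' \<Longrightarrow> oscillation_le D' h"
  by (fastforce simp: oscillation_le_def)

lemma oscillation_le_self: "0 \<le> D \<Longrightarrow> oscillation_le D (log_ratio p p)"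
  by (simp add: oscillation_le_def log_ratio_def)

text \<open>As \<open>ln 2 < 1\<close>, each log ratio lies between -1 and 1.\<close>

lemma oscillation_le_half:
  assumes "distribution p" "distribution p'" and le: "\<And>c. c \<in> {1..4} \<Longrightarrow> p c \<le> 1/2 \<and> p' c \<le> 1/2"
  shows "oscillation_le 2 (log_ratio p p')"
proof -
  have ln_bounds: "- 1 \<le> ln t \<and> ln t \<le> 0" if "1/2 \<le> t \<and> t \<le> 1" for t :: real
  proof -
    have "ln (1/2) \<le> ln t" using that by simp
    then show ?thesis using that ln_2_less_1 by (simp add: ln_div)
  qed
  show ?thesis
    unfolding oscillation_le_def log_ratio_def
  proof (intro ballI)
    fix c d :: nat assume "c \<in> {1..4}" "d \<in> {1..4}"
    then have *: "1/2 \<le> 1 - q j \<and> 1 - q j \<le> 1" if "j \<in> {c, d}" "q \<in> {p, p'}" for j q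
      using that le assms(1,2) distribution_nonneg by force
    show "ln (1 - p' c) - ln (1 - p c) - (ln (1 - p' d) - ln (1 - p d)) \<le> 2"
      using *[of c p, THEN ln_bounds] *[of d p, THEN ln_bounds] *[of c p', THEN ln_bounds]
        *[of d p', THEN ln_bounds] by simp
  qed
qed

lemma abs_diff_le_ln:
  fixes a b :: real
  assumes "0 < a" "a \<le> 1" "0 < b" "b \<le> 1"
  shows "\<bar>a - b\<bar> \<le> \<bar>ln a - ln b\<bar>"
proof -
  have *: "s - r \<le> ln s - ln r" if "0 < r" "r \<le> s" "s \<le> 1" for r s :: real
  proof -
    have "s - r \<le> (s - r) / s" using that mult_left_le[of s "s - r"] by (simp add: pos_le_divide_eq)
    also have "\<dots> = - (r / s - 1)" using that by (simp add: field_simps)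
    also have "\<dots> \<le> - ln (r / s)" using ln_le_minus_one[of "r / s"] that by simp
    finally show ?thesis using that by (simp add: ln_div)
  qed
  show ?thesis using *[of a b] *[of b a] assms by (cases "a \<le> b") auto
qed

text \<open>The numbers \<open>1 - p k\<close> and \<open>1 - p' k\<close> both sum to 3, so the log
  ratio cannot have one strict sign on all colors, and its oscillation bounds its absolute value. On
  the unit interval ln does not shrink distances.\<close>

lemma abs_diff_le_oscillation:
  assumes "distribution p" "distribution p'" and lt: "\<And>c. c \<in> {1..4} \<Longrightarrow> p c < 1 \<and> p' c < 1"
    and osc: "oscillation_le D (log_ratio p p')" and c: "c \<in> {1..4}"
  shows "\<bar>p c - p' c\<bar> \<le> D"
proof -
  have sums: "(\<Sum>k\<in>{1..4}. 1 - p k) = (\<Sum>k\<in>{1..4}. 1 - p' k)"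
    using assms(1,2) by (simp add: distribution_def sum_subtractf)
  have "log_ratio p p' c \<le> D"
  proof (rule ccontr)
    assume "\<not> ?thesis"
    then have "ln (1 - p k) < ln (1 - p' k)" if "k \<in> {1..4}" for k
      using osc c that by (force simp: oscillation_le_def log_ratio_def)
    then have "(\<Sum>k\<in>{1..4::nat}. 1 - p k) < (\<Sum>k\<in>{1..4}. 1 - p' k)"
      using lt by (intro sum_strict_mono) auto
    then show False using sums by simp
  qed
  moreover have "- D \<le> log_ratio p p' c"
  proof (rule ccontr)
    assume "\<not> ?thesis"
    then have "ln (1 - p' k) < ln (1 - p k)" if "k \<in> {1..4}" for k
      using osc c that by (force simp: oscillation_le_def log_ratio_def)
    then have "(\<Sum>k\<in>{1..4::nat}. 1 - p' k) < (\<Sum>k\<in>{1..4}. 1 - p k)"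
      using lt by (intro sum_strict_mono) auto
    then show False using sums by simp
  qed
  ultimately have "\<bar>ln (1 - p c) - ln (1 - p' c)\<bar> \<le> D"
    by (simp add: log_ratio_def abs_le_iff)
  moreover have "\<bar>(1 - p c) - (1 - p' c)\<bar> \<le> \<bar>ln (1 - p c) - ln (1 - p' c)\<bar>"
    using lt[OF c] assms(1,2) c by (intro abs_diff_le_ln) (auto simp: distribution_nonneg)
  ultimately show ?thesis by simp
qed

text \<open>The messages of a vertex at distance \<open>n\<close> from the boundary of a ball, under two boundary
  conditions which agree on all pinned vertices inside the ball.\<close>

inductive message_pair :: "nat \<Rightarrow> (nat \<Rightarrow> real) \<Rightarrow> (nat \<Rightarrow> real) \<Rightarrow> bool" where
  same: "distribution p \<Longrightarrow> message_pair n p p"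
| leaf: "distribution p \<Longrightarrow> distribution p' \<Longrightarrow> message_pair 0 p p'"
| step: "message_pair n x x' \<Longrightarrow> message_pair n y y' \<Longrightarrow>
    message_pair (Suc n) (combine x y) (combine x' y')"

section \<open>Live messages and their exponential decay\<close>

lemma message_pair_distribution:
  "message_pair n p p' \<Longrightarrow> distribution p \<and> distribution p'"
  by (induction rule: message_pair.induct) (auto simp: distribution_combine)

lemma message_pair_sym: "message_pair n p p' \<Longrightarrow> message_pair n p' p"
  by (induction rule: message_pair.induct) (auto intro: message_pair.intros)

lemma message_pair_live:
  assumes "message_pair (Suc n) p p'" "p \<noteq> p'"
  obtains x x' y y' where "message_pair n x x'" "message_pair n y y'" "x \<noteq> x'"
    "p = combine x y" "p' = combine x' y'"
  using assms
proof (cases rule: message_pair.cases)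
  case (step x x' y y')
  then show ?thesis
    using that[of x x' y y'] that[of y y' x x'] assms(2) combine_commute[of x y] combine_commute[of x' y'] by auto
qed (use assms in auto)

text \<open>Liveness excludes a pinned vertex and \<open>Suc n\<close> excludes a leaf; either may
  send a message concentrated on one color.\<close>

lemma message_pair_half:
  assumes "message_pair (Suc n) p p'" "p \<noteq> p'" "c \<in> {1..4}"
  shows "p c \<le> 1/2"
  using assms(1,2)
proof (rule message_pair_live)
  fix x x' y y' assume "message_pair n x x'" "message_pair n y y'" "p = combine x y"
  then show ?thesis using combine_le_half assms(3) message_pair_distribution by blast
qed

lemma message_pair_balanced:
  assumes "message_pair (Suc (Suc n)) p p'" "p \<noteq> p'"
  shows "balanced (1/2) (6/5) p"
  using assms(1,2)
proof (rule message_pair_live)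
  fix x x' y y' assume *: "message_pair (Suc n) x x'" "message_pair (Suc n) y y'" "x \<noteq> x'" "p = combine x y"
  then show ?thesis
    using balanced_combine_single[of y x] message_pair_half[OF *(1,3)]
      message_pair_distribution[OF *(1)] message_pair_distribution[OF *(2)]
    by (simp add: combine_commute[of x y])
qed

lemma message_pair_off_diagonal:
  assumes "message_pair (Suc (Suc n)) p p'" "p \<noteq> p'" "c \<in> {1..4}" "a \<in> {1..4}" "c \<noteq> a"
  shows "1 \<le> 11 * p c + 5 * p a"
  using assms(1,2)
proof (rule message_pair_live)
  fix x x' y y' assume *: "message_pair (Suc n) x x'" "message_pair (Suc n) y y'" "x \<noteq> x'" "p = combine x y"
  then show ?thesis
    using combine_off_diagonal[of y x c a] message_pair_half[OF *(1,3)] assms(3-5)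
      message_pair_distribution[OF *(1)] message_pair_distribution[OF *(2)]
    by (simp add: combine_commute[of x y])
qed

text \<open>Bounds improve with the height above the arbitrary leaf messages: 1/2 after one level,
  the off-diagonal bound after two, 5/11 after three. This is why the decay estimate starts a few
  levels above the leaves.\<close>

lemma message_pair_five_elevenths:
  assumes "message_pair (Suc (Suc (Suc n))) p p'" "p \<noteq> p'" "c \<in> {1..4}"
  shows "p c \<le> 5/11"
  using assms(1,2)
proof (rule message_pair_live)
  fix x x' y y' assume *: "message_pair (Suc (Suc n)) x x'" "message_pair (Suc (Suc n)) y y'" "x \<noteq> x'" "p = combine x y"
  then show ?thesis
    using combine_le_five_elevenths[of y x c] message_pair_off_diagonal[OF *(1,3)] assms(3)
      message_pair_distribution[OF *(1)] message_pair_distribution[OF *(2)]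
    by (simp add: combine_commute[of x y])
qed

text \<open>In the critical case two equal oscillations meet the coefficient 4999/10000, a total
  factor of 9998/10000; \<open>\<kappa>\<close> lies between this and 1.\<close>

definition \<kappa> :: real where "\<kappa> = 9999/10000"

lemma oscillation_combine_balanced:
  assumes dist: "distribution x" "distribution y" "distribution x'" "distribution y'"
    and lt: "\<And>c. c \<in> {1..4} \<Longrightarrow> x c < 1 \<and> x' c < 1 \<and> y c < 1 \<and> y' c < 1"
    and x: "balanced lo s x" "balanced lo s x'" "oscillation_le D (log_ratio x x')"
    and y: "balanced lo' s' y" "balanced lo' s' y'" "oscillation_le D' (log_ratio y y')"
    and nonneg: "0 \<le> lo" "0 \<le> lo'"
    and \<rho>: "0 \<le> \<rho>" "\<rho> < 1" "1 \<le> \<rho> * (1 + lo * s' + lo' * s - 2 * lo * lo')" "\<rho> * (D + D') \<le> B"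
  shows "oscillation_le B (log_ratio (combine x y) (combine x' y'))"
proof (rule oscillation_le_mono[OF oscillation_combine \<rho>(4)])
  show "contraction_bound \<rho> (combine x y)" "contraction_bound \<rho> (combine x' y')"
    using contraction_bound_double[OF _ _ _ _ nonneg \<rho>(1,3)] dist x y by auto
qed (use assms in auto)

text \<open>The weights of a vertex with one and with two live children, \<open>14/5\<close> and \<open>4\<close>, are chosen such
  that each case below gains a factor \<open>\<kappa>\<close>.  The critical case is that of two live children which
  have two live children each.\<close>

lemma message_pair_oscillation:
  assumes "message_pair (n + 4) p p'" "p \<noteq> p'"
  shows "balanced (1/2) (6/5) p \<and> balanced (1/2) (6/5) p' \<and>
      oscillation_le (14/5 * \<kappa> ^ n) (log_ratio p p') \<or>
    balanced (156/241) (365/257) p \<and> balanced (156/241) (365/257) p' \<and>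
      oscillation_le (4 * \<kappa> ^ n) (log_ratio p p')"
  using assms
proof (induction n arbitrary: p p')
  case 0
  have "0 + 4 = Suc (Suc (Suc (Suc 0)))" by simp
  with 0 have pair: "message_pair (Suc (Suc (Suc (Suc 0)))) p p'" by (simp only:)
  have dist: "distribution p" "distribution p'"
    using message_pair_distribution[OF pair] by auto
  have osc: "oscillation_le 2 (log_ratio p p')"
    using message_pair_half[OF pair] message_pair_half[OF message_pair_sym[OF pair]] 0(2) dist
    by (intro oscillation_le_half) auto
  then have "oscillation_le (14/5 * \<kappa> ^ 0) (log_ratio p p')" "oscillation_le (4 * \<kappa> ^ 0) (log_ratio p p')"
    by (auto intro: oscillation_le_mono)
  moreover have "balanced (1/2) (6/5) p" "balanced (1/2) (6/5) p'"
    using message_pair_balanced[OF pair] message_pair_balanced[OF message_pair_sym[OF pair]] 0(2) by auto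
  ultimately show ?case by blast
next
  case (Suc n)
  then have pair: "message_pair (Suc (n + 4)) p p'" by simp
  have "n + 4 = Suc (n + 3)" by simp
  with pair have pair': "message_pair (Suc (Suc (n + 3))) p p'" by (simp only:)
  from pair Suc.prems(2) show ?case
  proof (rule message_pair_live)
    fix x x' y y'
    assume x: "message_pair (n + 4) x x'" "x \<noteq> x'" and y: "message_pair (n + 4) y y'"
      and p: "p = combine x y" "p' = combine x' y'"
    have n4: "n + 4 = Suc (Suc (Suc (Suc n)))" by simp
    have half: "q c \<le> 1/2 \<and> q' c \<le> 1/2" if "message_pair (n + 4) q q'" "q \<noteq> q'" "c \<in> {1..4}" for q q' c
      using message_pair_half[OF that[unfolded n4]] message_pair_half[OF message_pair_sym[OF that(1)[unfolded n4]] _ that(3)]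
        that(2) by auto
    have small: "q c \<le> 5/11 \<and> q' c \<le> 5/11" if "message_pair (n + 4) q q'" "q \<noteq> q'" "c \<in> {1..4}" for q q' c
      using message_pair_five_elevenths[OF that[unfolded n4]]
        message_pair_five_elevenths[OF message_pair_sym[OF that(1)[unfolded n4]] _ that(3)] that(2) by auto
    have dist: "distribution x" "distribution y" "distribution x'" "distribution y'"
      using x y message_pair_distribution by auto
    have \<kappa>: "\<kappa> ^ n \<ge> 0" "\<kappa> ^ Suc n = 9999/10000 * \<kappa> ^ n" by (auto simp: \<kappa>_def)
    note IHx = Suc.IH[OF x]
    show ?case
    proof (cases "y = y'")
      case True
      have "oscillation_le (4 * \<kappa> ^ n) (log_ratio x x')"
        using IHx oscillation_le_mono[of "14/5 * \<kappa> ^ n" _ "4 * \<kappa> ^ n"] \<kappa>(1) by auto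
      \<comment> \<open>The only live child may carry the larger weight: 2/3 * 4 = 8/3 is below
        \<open>14/5 * \<kappa>\<close>. This case bounds the smaller weight from below, those with
        two live children bound it from above.\<close>
      then have "oscillation_le (2/3 * (4 * \<kappa> ^ n + 0)) (log_ratio p p')"
        unfolding p
      proof (intro oscillation_combine)
        show "x = x' \<or> (\<forall>c\<in>{1..4}. x c < 1 \<and> x' c < 1)"
          using half[OF x] by force
        show "contraction_bound (2/3) (combine x y)" "contraction_bound (2/3) (combine x' y')"
          unfolding combine_commute[of x y] combine_commute[of x' y']
          using dist half[OF x] by (auto intro: contraction_bound_single)
      qed (use dist True in \<open>auto intro: oscillation_le_self\<close>)
      then have "oscillation_le (14/5 * \<kappa> ^ Suc n) (log_ratio p p')"
        unfolding \<kappa>(2) by (rule oscillation_le_mono) (use \<kappa>(1) in simp)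
      moreover have "balanced (1/2) (6/5) p" "balanced (1/2) (6/5) p'"
        using message_pair_balanced[OF pair'] message_pair_balanced[OF message_pair_sym[OF pair']]
          Suc.prems(2) by auto
      ultimately show ?thesis by blast
    next
      case False
      note IHy = Suc.IH[OF y False]
      have lt: "x c < 1 \<and> x' c < 1 \<and> y c < 1 \<and> y' c < 1" if "c \<in> {1..4}" for c
        using half[OF x that] half[OF y False that] by auto
      note bound = oscillation_combine_balanced[OF dist lt]
      \<comment> \<open>The coefficients 3/5, 11/20 and 4999/10000 slightly exceed the reciprocals
        of \<open>1 + lo * s' + lo' * s - 2 * lo * lo'\<close>, which is 1.7, about 1.8396 and about
        2.0006. They turn the sums 28/5, 34/5 and 8 into 3.36, 3.74 and 3.9992, all below
        \<open>4 * \<kappa>\<close>.\<close>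
      have "oscillation_le (4 * \<kappa> ^ Suc n) (log_ratio p p')"
        using IHx IHy unfolding p \<kappa>(2)
      proof (elim disjE conjE, goal_cases)
        case 1
        show ?case
          by (rule bound[where lo = "1/2" and s = "6/5" and lo' = "1/2" and s' = "6/5" and \<rho> = "3/5"
                and D = "14/5 * \<kappa> ^ n" and D' = "14/5 * \<kappa> ^ n"]) (use 1 \<kappa>(1) in auto)
      next
        case 2
        show ?case
          by (rule bound[where lo = "1/2" and s = "6/5" and lo' = "156/241" and s' = "365/257" and \<rho> = "11/20"
                and D = "14/5 * \<kappa> ^ n" and D' = "4 * \<kappa> ^ n"]) (use 2 \<kappa>(1) in auto)
      next
        case 3
        show ?case
          by (rule bound[where lo = "156/241" and s = "365/257" and lo' = "1/2" and s' = "6/5" and \<rho> = "11/20"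
                and D = "4 * \<kappa> ^ n" and D' = "14/5 * \<kappa> ^ n"]) (use 3 \<kappa>(1) in auto)
      next
        case 4
        show ?case
          by (rule bound[where lo = "156/241" and s = "365/257" and lo' = "156/241" and s' = "365/257" and \<rho> = "4999/10000"
                and D = "4 * \<kappa> ^ n" and D' = "4 * \<kappa> ^ n"]) (use 4 \<kappa>(1) in auto)
      qed
      moreover have "balanced (156/241) (365/257) p" "balanced (156/241) (365/257) p'"
        unfolding p using dist small[OF x] small[OF y False] by (auto intro!: balanced_combine_double)
      ultimately show ?thesis by blast
    qed
  qed
qed

lemma message_pair_decay:
  assumes "message_pair n p p'" "c \<in> {1..4}"
  shows "\<bar>p c - p' c\<bar> \<le> 5 * \<kappa> ^ n"
proof -
  have dist: "distribution p" "distribution p'"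
    using message_pair_distribution[OF assms(1)] by auto
  consider "p = p'" | "n < 4" | "p \<noteq> p'" "n \<ge> 4" by linarith
  then show ?thesis
  proof cases
    case 2
    have "\<bar>p c - p' c\<bar> \<le> 1"
      using dist assms(2) distribution_nonneg[of p c] distribution_nonneg[of p' c]
        distribution_le_one[of p c] distribution_le_one[of p' c] by linarith
    \<comment> \<open>The constant 5 absorbs the four lowest levels, because
      \<open>4 \<le> 5 * \<kappa> ^ 4\<close>.\<close>
    also have "1 \<le> 5 * \<kappa> ^ 4" by (simp add: \<kappa>_def power_divide)
    also have "\<dots> \<le> 5 * \<kappa> ^ n" using 2 by (simp add: \<kappa>_def power_decreasing)
    finally show ?thesis .
  next
    case 3
    then obtain m where m: "n = m + 4" by (metis le_add_diff_inverse2)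
    have "n = Suc (m + 3)" by (simp add: m)
    with assms(1) have pair: "message_pair (Suc (m + 3)) p p'" by (simp only:)
    have lt: "p c < 1 \<and> p' c < 1" if "c \<in> {1..4}" for c
      using message_pair_half[OF pair 3(1) that] message_pair_half[OF message_pair_sym[OF pair] _ that] 3(1) by auto
    have \<kappa>: "0 \<le> \<kappa> ^ m" "\<kappa> ^ n = \<kappa> ^ 4 * \<kappa> ^ m" by (auto simp: \<kappa>_def m power_add)
    have "oscillation_le (4 * \<kappa> ^ m) (log_ratio p p')"
      using message_pair_oscillation[of m p p'] assms(1) 3(1)
        oscillation_le_mono[of "14/5 * \<kappa> ^ m" _ "4 * \<kappa> ^ m"] \<kappa>(1) by (auto simp: m)
    then have "\<bar>p c - p' c\<bar> \<le> 4 * \<kappa> ^ m"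
      using abs_diff_le_oscillation[OF dist lt] assms(2) by blast
    also have "\<dots> \<le> (5 * \<kappa> ^ 4) * \<kappa> ^ m"
      using \<kappa>(1) by (intro mult_right_mono) (auto simp: \<kappa>_def power_divide)
    finally show ?thesis by (simp add: \<kappa>(2))
  qed (simp add: \<kappa>_def)
qed

subsection \<open>The rooted regular tree\<close>

text \<open>Loop erasure: if the new first vertex already occurs, everything before that occurrence
  is dropped. Distinctness is needed to form an \<open>is_cycle\<close>.\<close>

lemma rtrancl_distinct_path:
  assumes "(x, z) \<in> S\<^sup>*"
  shows "\<exists>xs. xs \<noteq> [] \<and> hd xs = x \<and> last xs = z \<and> distinct xs \<and>
    (\<forall>i. Suc i < length xs \<longrightarrow> (xs ! i, xs ! Suc i) \<in> S)"
  using assms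
proof (induction rule: converse_rtrancl_induct)
  case base
  show ?case by (intro exI[of _ "[z]"]) simp
next
  case (step x y)
  then obtain xs where xs: "xs \<noteq> []" "hd xs = y" "last xs = z" "distinct xs"
    and path: "\<And>i. Suc i < length xs \<Longrightarrow> (xs ! i, xs ! Suc i) \<in> S" by blast
  show ?case
  proof (cases "x \<in> set xs")
    case True
    then obtain ys zs where split: "xs = ys @ x # zs" by (meson split_list)
    have "(xs ! (length ys + i), xs ! Suc (length ys + i)) \<in> S" if "Suc i < length (x # zs)" for i
      using path[of "length ys + i"] that by (simp add: split)
    then have "((x # zs) ! i, (x # zs) ! Suc i) \<in> S" if "Suc i < length (x # zs)" for i
      using that unfolding split by (simp add: nth_append)
    then show ?thesis using xs by (intro exI[of _ "x # zs"]) (auto simp: split)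
  next
    case False
    have "((x # xs) ! i, (x # xs) ! Suc i) \<in> S" if "Suc i < length (x # xs)" for i
    proof (cases i)
      case 0
      then show ?thesis using step.hyps(1) xs(1,2) by (simp add: hd_conv_nth)
    next
      case (Suc j)
      then show ?thesis using path[of j] that by simp
    qed
    then show ?thesis using xs False by (intro exI[of _ "x # xs"]) auto
  qed
qed

lemma no_path_between_neighbors:
  assumes acyclic: "\<nexists>xs. is_cycle E xs" and edges: "{u, x} \<in> E" "{u, y} \<in> E" and "x \<noteq> y"
    and path: "(x, y) \<in> (adj_rel E \<inter> (- {u}) \<times> (- {u}))\<^sup>*" and "x \<noteq> u"
  shows False
proof -
  obtain xs where xs: "xs \<noteq> []" "hd xs = x" "last xs = y" "distinct xs"
    and step: "\<And>i. Suc i < length xs \<Longrightarrow> (xs ! i, xs ! Suc i) \<in> adj_rel E \<inter> (- {u}) \<times> (- {u})"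
    using rtrancl_distinct_path[OF path] by blast
  obtain a b ys where ab: "xs = a # b # ys"
    using xs \<open>x \<noteq> y\<close> by (cases xs; cases "tl xs") auto
  have "u \<notin> set xs"
  proof
    assume "u \<in> set xs"
    then obtain i where i: "i < length xs" "xs ! i = u" by (auto simp: in_set_conv_nth)
    have "i \<noteq> 0"
    proof
      assume "i = 0"
      then show False using i xs(1,2) \<open>x \<noteq> u\<close> by (simp add: hd_conv_nth)
    qed
    then obtain j where "i = Suc j" by (cases i) auto
    then show False using step[of j] i by auto
  qed
  have "is_cycle E (u # xs)"
    unfolding is_cycle_def
  proof (intro conjI allI impI)
    fix i assume i: "Suc i < length (u # xs)"
    show "{(u # xs) ! i, (u # xs) ! Suc i} \<in> E"
    proof (cases i)
      case 0
      then show ?thesis using edges(1) xs(1,2) by (simp add: hd_conv_nth)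
    next
      case (Suc j)
      then show ?thesis using step[of j] i by (simp add: adj_rel_def)
    qed
  qed (use xs edges \<open>u \<notin> set xs\<close> ab in \<open>auto simp: insert_commute\<close>)
  then show False using acyclic by blast
qed

section \<open>Levels, children and subtrees seen from a root\<close>

locale rooted_cubic_tree =
  fixes V :: "'v set" and E :: "'v set set" and r :: 'v
  assumes regular_tree: "infinite_regular_tree 3 V E" and root: "r \<in> V"
begin

lemma acyclic: "\<nexists>xs. is_cycle E xs"
  and connected: "u \<in> V \<Longrightarrow> w \<in> V \<Longrightarrow> (u, w) \<in> (adj_rel E)\<^sup>*"
  and card_neighbors: "u \<in> V \<Longrightarrow> card {w. {u, w} \<in> E} = 3"
  and simple: "simple_graph V E"
  using regular_tree
  by (auto simp: infinite_regular_tree_def tree_def connected_graph_def degree_def)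

lemma edgeD:
  assumes "{u, w} \<in> E"
  shows "u \<in> V" "w \<in> V" "u \<noteq> w"
proof -
  obtain a b where "a \<in> V" "b \<in> V" "a \<noteq> b" "{u, w} = {a, b}"
    using simple assms unfolding simple_graph_def by meson
  then show "u \<in> V" "w \<in> V" "u \<noteq> w" by (auto simp: doubleton_eq_iff)
qed

lemma finite_neighbors: "u \<in> V \<Longrightarrow> finite {w. {u, w} \<in> E}"
  using card_neighbors card.infinite by fastforce

definition level :: "'v \<Rightarrow> nat" where
  "level u = graph_dist E r u"

lemma level_path: "u \<in> V \<Longrightarrow> (r, u) \<in> adj_rel E ^^ level u"
  unfolding level_def graph_dist_def
  by (rule LeastI_ex) (use connected[OF root] in \<open>simp add: rtrancl_power\<close>)

lemma level_le: "(r, u) \<in> adj_rel E ^^ n \<Longrightarrow> level u \<le> n"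
  unfolding level_def graph_dist_def by (rule Least_le)

lemma level_root [simp]: "level r = 0"
  using level_le[of r 0] by simp

lemma level_eq_0: "u \<in> V \<Longrightarrow> level u = 0 \<Longrightarrow> u = r"
  using level_path[of u] by simp

lemma level_edge:
  assumes "{u, w} \<in> E"
  shows "level w \<le> Suc (level u)"
proof -
  have "(r, w) \<in> adj_rel E ^^ Suc (level u)"
    using level_path[OF edgeD(1)[OF assms]] assms by (auto simp: adj_rel_def)
  then show ?thesis by (rule level_le)
qed

lemma lower_neighbor:
  assumes "u \<in> V" "u \<noteq> r"
  obtains w where "{u, w} \<in> E" "level u = Suc (level w)"
proof -
  obtain n where n: "level u = Suc n"
    using level_eq_0 assms by (metis not0_implies_Suc)
  then obtain w where w: "(r, w) \<in> adj_rel E ^^ n" "(w, u) \<in> adj_rel E"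
    using level_path[OF assms(1)] by auto
  then have edge: "{u, w} \<in> E" by (simp add: adj_rel_def insert_commute)
  have "level w = n"
    using level_le[OF w(1)] level_edge[of w u] edge n by (simp add: insert_commute)
  then show ?thesis using that edge n by blast
qed

text \<open>Descending one level per step, the path is strictly below the level of \<open>u\<close>
  after its first vertex.\<close>

lemma path_to_root_avoiding:
  assumes "u \<in> V" "w \<in> V" "w \<noteq> u" "level w \<le> level u"
  shows "(w, r) \<in> (adj_rel E \<inter> (- {u}) \<times> (- {u}))\<^sup>*"
  using assms(2-4)
proof (induction "level w" arbitrary: w)
  case 0
  then show ?case using level_eq_0[of w] by simp
next
  case (Suc n)
  then have "w \<noteq> r" by auto
  then obtain x where x: "{w, x} \<in> E" "level w = Suc (level x)"
    using lower_neighbor Suc.prems by blast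
  then have xu: "x \<noteq> u" "level x \<le> level u" using Suc.prems by auto
  then have "(x, r) \<in> (adj_rel E \<inter> (- {u}) \<times> (- {u}))\<^sup>*"
    using Suc.hyps x edgeD(2)[OF x(1)] by auto
  moreover have "(w, x) \<in> adj_rel E \<inter> (- {u}) \<times> (- {u})"
    using x xu Suc.prems by (auto simp: adj_rel_def)
  ultimately show ?case by (rule converse_rtrancl_into_rtrancl[rotated])
qed

text \<open>Two such neighbors would be joined through the root without meeting \<open>u\<close>,
  closing a cycle. Admitting equal levels makes the lemma exclude edges within a level as
  well.\<close>

lemma lower_neighbor_unique:
  assumes "{u, x} \<in> E" "{u, y} \<in> E" "level x \<le> level u" "level y \<le> level u"
  shows "x = y"
proof (rule ccontr)
  assume "x \<noteq> y"
  let ?S = "adj_rel E \<inter> (- {u}) \<times> (- {u})"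
  have "sym ?S" by (auto simp: sym_def adj_rel_def insert_commute)
  then have "sym (?S\<^sup>*)" by (rule sym_rtrancl)
  moreover have "(x, r) \<in> ?S\<^sup>*" "(y, r) \<in> ?S\<^sup>*"
    using assms edgeD[OF assms(1)] edgeD[OF assms(2)] by (auto intro!: path_to_root_avoiding)
  ultimately have "(x, y) \<in> ?S\<^sup>*" by (meson rtrancl_trans symD)
  then show False
    using no_path_between_neighbors[OF acyclic assms(1,2) \<open>x \<noteq> y\<close>] edgeD(3)[OF assms(1)] by blast
qed

definition children :: "'v \<Rightarrow> 'v set" where
  "children u = {w. {u, w} \<in> E \<and> level w = Suc (level u)}"

lemma children_in:
  assumes "w \<in> children u"
  shows "w \<in> V \<and> u \<in> V \<and> level w = Suc (level u)"
proof -
  have "{u, w} \<in> E" "level w = Suc (level u)" using assms by (auto simp: children_def)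
  then show ?thesis using edgeD[of u w] by simp
qed

lemma parent_unique:
  assumes "w \<in> children u" "w \<in> children u'"
  shows "u = u'"
proof (rule lower_neighbor_unique)
  show "{w, u} \<in> E" "{w, u'} \<in> E" "level u \<le> level w" "level u' \<le> level w"
    using assms by (simp_all add: children_def insert_commute)
qed

lemma edge_children:
  assumes "{u, w} \<in> E"
  shows "w \<in> children u \<or> u \<in> children w"
proof -
  have edge': "{w, u} \<in> E" using assms by (simp add: insert_commute)
  have "level u \<noteq> level w"
  proof
    assume eq: "level u = level w"
    have "u \<noteq> r"
    proof
      assume "u = r"
      then have "w = r" using eq level_eq_0[of w] edgeD(2)[OF assms] by simp
      then show False using \<open>u = r\<close> edgeD(3)[OF assms] by simp
    qed
    then obtain x where x: "{u, x} \<in> E" "level u = Suc (level x)"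
      using lower_neighbor edgeD(1)[OF assms] by blast
    have "x = w"
      by (rule lower_neighbor_unique[OF x(1) assms]) (use x(2) eq in linarith)+
    then show False using x(2) eq by simp
  qed
  then have "level w = Suc (level u) \<or> level u = Suc (level w)"
    using level_edge[OF assms] level_edge[OF edge'] by linarith
  then show ?thesis using assms edge' unfolding children_def by blast
qed

lemma finite_children: "finite (children u)"
proof (cases "u \<in> V")
  case True
  show ?thesis
    by (rule finite_subset[OF _ finite_neighbors[OF True]]) (auto simp: children_def)
next
  case False
  then have "children u = {}" using children_in by blast
  then show ?thesis by simp
qed

lemma card_children_root: "card (children r) = 3"
proof -
  have "w \<in> children r" if "{r, w} \<in> E" for w
    using edge_children[OF that] children_in[of r w] by auto
  then have "children r = {w. {r, w} \<in> E}"
    unfolding children_def by blast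
  then show ?thesis using card_neighbors[OF root] by simp
qed

lemma card_children:
  assumes "u \<in> V" "u \<noteq> r"
  shows "card (children u) = 2"
proof -
  obtain x where x: "{u, x} \<in> E" "level u = Suc (level x)"
    using lower_neighbor assms by blast
  have "children u = {w. {u, w} \<in> E} - {x}"
  proof (intro equalityI subsetI)
    fix w assume "w \<in> {w. {u, w} \<in> E} - {x}"
    then have w: "{u, w} \<in> E" "w \<noteq> x" by auto
    then have "\<not> level w \<le> level u"
      using lower_neighbor_unique[OF w(1) x(1)] x(2) by auto
    then show "w \<in> children u"
      using level_edge[OF w(1)] w by (auto simp: children_def)
  qed (use x in \<open>auto simp: children_def\<close>)
  then show ?thesis using card_neighbors[OF assms(1)] x finite_neighbors[OF assms(1)] by simp
qed

fun subtree :: "nat \<Rightarrow> 'v \<Rightarrow> 'v set" where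
  "subtree 0 u = {u}"
| "subtree (Suc n) u = insert u (\<Union>w\<in>children u. subtree n w)"

lemma self_in_subtree [simp]: "u \<in> subtree n u"
  by (cases n) auto

lemma finite_subtree: "finite (subtree n u)"
  by (induction n arbitrary: u) (auto simp: finite_children)

lemma subtree_level: "x \<in> subtree n u \<Longrightarrow> level u \<le> level x \<and> level x \<le> level u + n"
proof (induction n arbitrary: u)
  case (Suc n)
  then show ?case using children_in by fastforce
qed simp

lemma subtree_in: "u \<in> V \<Longrightarrow> subtree n u \<subseteq> V"
  by (induction n arbitrary: u) (use children_in in auto)

lemma subtree_path: "x \<in> subtree n u \<Longrightarrow> (u, x) \<in> {(y, w). w \<in> children y} ^^ (level x - level u)"
proof (induction n arbitrary: u)
  case (Suc n)
  show ?case
  proof (cases "x = u")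
    case False
    then obtain w where w: "w \<in> children u" "x \<in> subtree n w" using Suc.prems by auto
    then have "level x - level u = Suc (level x - level w)"
      using children_in[OF w(1)] subtree_level[OF w(2)] by auto
    then show ?thesis using relpow_Suc_I2[OF _ Suc.IH[OF w(2)], of u] w(1) by simp
  qed simp
qed simp

lemma ancestor_unique:
  "(u, x) \<in> {(y, w). w \<in> children y} ^^ n \<Longrightarrow> (u', x) \<in> {(y, w). w \<in> children y} ^^ n \<Longrightarrow> u = u'"
proof (induction n arbitrary: x)
  case (Suc n)
  then obtain y y' where y: "(u, y) \<in> {(y, w). w \<in> children y} ^^ n" "x \<in> children y"
    and y': "(u', y') \<in> {(y, w). w \<in> children y} ^^ n" "x \<in> children y'"
    by (auto elim!: relpow_Suc_E)
  then have "y = y'" using parent_unique by blast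
  then show ?case using Suc.IH[OF y(1)] y'(1) by simp
qed simp

text \<open>The number of steps from \<open>x\<close> up to \<open>w\<close> and \<open>w'\<close>
  is the difference of levels, and parents are unique.\<close>

lemma subtree_disjoint:
  assumes "x \<in> subtree n w" "x \<in> subtree n w'" "level w = level w'"
  shows "w = w'"
  using ancestor_unique subtree_path[OF assms(1)] subtree_path[OF assms(2)] assms(3) by metis

lemma subtree_parent: "x \<in> subtree n u \<Longrightarrow> x \<noteq> u \<Longrightarrow> x \<in> children y \<Longrightarrow> y \<in> subtree n u"
proof (induction n arbitrary: u)
  case (Suc n)
  then obtain w where w: "w \<in> children u" "x \<in> subtree n w" by auto
  show ?case
  proof (cases "x = w")
    case True
    then show ?thesis using parent_unique Suc.prems w by auto
  next
    case False
    then show ?thesis using Suc.IH[OF w(2) _ Suc.prems(3)] w(1) by auto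
  qed
qed simp

lemma subtree_root: "subtree n r = {x \<in> V. level x \<le> n}"
proof (intro equalityI subsetI)
  fix x assume "x \<in> subtree n r"
  then show "x \<in> {x \<in> V. level x \<le> n}" using subtree_in[OF root] subtree_level by fastforce
next
  have "x \<in> V \<Longrightarrow> level x \<le> n \<Longrightarrow> x \<in> subtree n r" for x
  proof (induction "level x" arbitrary: x)
    case 0
    then show ?case using level_eq_0[of x] by simp
  next
    case (Suc m)
    then have "x \<noteq> r" by auto
    then obtain y where y: "{x, y} \<in> E" "level x = Suc (level y)"
      using lower_neighbor Suc.prems by blast
    then have "y \<in> subtree n r" "x \<in> children y"
      using Suc edgeD[OF y(1)] by (auto simp: children_def insert_commute)
    moreover have "z \<in> subtree k u \<Longrightarrow> w \<in> children z \<Longrightarrow> level w \<le> level u + k \<Longrightarrow> w \<in> subtree k u"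
      for z w k u
    proof (induction k arbitrary: u)
      case 0
      then show ?case using children_in by fastforce
    next
      case (Suc k)
      show ?case
      proof (cases "z = u")
        case False
        then obtain a where "a \<in> children u" "z \<in> subtree k a" using Suc.prems by auto
        then show ?thesis using Suc.IH[of a] Suc.prems children_in by fastforce
      qed (use Suc.prems in \<open>auto intro: bexI[of _ w]\<close>)
    qed
    ultimately show ?case using Suc.prems by simp
  qed
  then show "x \<in> subtree n r" if "x \<in> {x \<in> V. level x \<le> n}" for x using that by blast
qed

text \<open>No edge joins the subtrees of different children; this is what makes the colorings of
  these subtrees independent given the color of \<open>u\<close>.\<close>

lemma subtree_edge:
  assumes "{x, y} \<in> E" "x \<in> subtree (Suc n) u" "y \<in> subtree (Suc n) u"
  shows "x = u \<and> y \<in> children u \<or> y = u \<and> x \<in> children u \<or>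
    (\<exists>w\<in>children u. x \<in> subtree n w \<and> y \<in> subtree n w)"
proof -
  have *: "x = u \<or> (\<exists>w\<in>children u. x \<in> subtree n w \<and> y \<in> subtree n w)"
    if h: "y \<in> children x" "x \<in> subtree (Suc n) u" "y \<in> subtree (Suc n) u" for x y
  proof (cases "x = u")
    case False
    have "level y > level u"
      using children_in[OF h(1)] subtree_level[OF h(2)] by auto
    then obtain w where w: "w \<in> children u" "y \<in> subtree n w" using h by auto
    then have "y \<noteq> w" using False parent_unique h(1) by blast
    then show ?thesis using subtree_parent[OF w(2) _ h(1)] w by blast
  qed simp
  show ?thesis using edge_children[OF assms(1)] *[of y x] *[of x y] assms by blast
qed

text \<open>\<open>U\<close> may be infinite; countability makes agreement with a coloring on
  \<open>U\<close> a measurable event.\<close>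

lemma countable_vertices: "countable V"
proof -
  have "V \<subseteq> (\<Union>n. subtree n r)" using subtree_root by blast
  then show ?thesis
    by (rule countable_subset) (auto intro: countable_finite finite_subtree)
qed

end

subsection \<open>Counting colorings of a ball\<close>

text \<open>For the three children of the root. The 15 is 3 + 12: one product changes by at most
  \<open>3 * \<epsilon>\<close>, the sum of four of them by \<open>12 * \<epsilon>\<close>, and the
  denominators are at least 1.\<close>

lemma normalized_product_close:
  fixes f g :: "'a \<Rightarrow> nat \<Rightarrow> real"
  assumes card: "card W = 3"
    and f: "\<And>w. w \<in> W \<Longrightarrow> distribution (f w)" and g: "\<And>w. w \<in> W \<Longrightarrow> distribution (g w)"
    and close: "\<And>w c. w \<in> W \<Longrightarrow> c \<in> {1..4} \<Longrightarrow> \<bar>f w c - g w c\<bar> \<le> \<epsilon>" and c: "c \<in> {1..4}"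
  shows "\<bar>(\<Prod>w\<in>W. 1 - f w c) / (\<Sum>k\<in>{1..4}. \<Prod>w\<in>W. 1 - f w k)
    - (\<Prod>w\<in>W. 1 - g w c) / (\<Sum>k\<in>{1..4}. \<Prod>w\<in>W. 1 - g w k)\<bar> \<le> 15 * \<epsilon>"
proof -
  have W: "finite W" using card by (metis card.infinite zero_neq_numeral)
  define A B where "A k = (\<Prod>w\<in>W. 1 - f w k)" and "B k = (\<Prod>w\<in>W. 1 - g w k)" for k
  define S T where "S = (\<Sum>k\<in>{1..4}. A k)" and "T = (\<Sum>k\<in>{1..4}. B k)"
  \<comment> \<open>Each product is at least one minus the sum of its three probabilities, and over
    all colors this gives 4 - 3.\<close>
  have sum_ge: "1 \<le> (\<Sum>k\<in>{1..4::nat}. \<Prod>w\<in>W. 1 - h w k)"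
    if h: "\<And>w. w \<in> W \<Longrightarrow> distribution (h w)" for h :: "'a \<Rightarrow> nat \<Rightarrow> real"
  proof -
    have "(\<Sum>k\<in>{1..4::nat}. 1 - (\<Sum>w\<in>W. h w k)) \<le> (\<Sum>k\<in>{1..4}. \<Prod>w\<in>W. 1 - h w k)"
      by (intro sum_mono Weierstrass_prod_ineq) (use h in \<open>auto simp: distribution_nonneg distribution_le_one\<close>)
    moreover have "(\<Sum>k\<in>{1..4::nat}. \<Sum>w\<in>W. h w k) = 3"
      by (subst sum.swap) (use h card in \<open>simp add: distribution_def\<close>)
    ultimately show ?thesis by (simp add: sum_subtractf)
  qed
  have S: "1 \<le> S" and T: "1 \<le> T"
    using sum_ge[of f] sum_ge[of g] f g by (auto simp: S_def T_def A_def B_def)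
  have diff: "\<bar>A k - B k\<bar> \<le> 3 * \<epsilon>" if k: "k \<in> {1..4}" for k
  proof -
    have "\<bar>A k - B k\<bar> \<le> (\<Sum>w\<in>W. \<bar>(1 - f w k) - (1 - g w k)\<bar>)"
      unfolding A_def B_def real_norm_def[symmetric]
      by (rule norm_prod_diff) (use f g k in \<open>auto simp: distribution_nonneg distribution_le_one\<close>)
    also have "\<dots> \<le> (\<Sum>w\<in>W. \<epsilon>)"
      using close[OF _ k] by (intro sum_mono) (simp add: abs_minus_commute)
    finally show ?thesis using card by simp
  qed
  have "\<bar>S - T\<bar> \<le> (\<Sum>k\<in>{1..4::nat}. \<bar>A k - B k\<bar>)"
    unfolding S_def T_def sum_subtractf[symmetric] by (rule sum_abs)
  also have "\<dots> \<le> (\<Sum>k\<in>{1..4::nat}. 3 * \<epsilon>)" using diff by (intro sum_mono) auto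
  finally have ST: "\<bar>T - S\<bar> \<le> 12 * \<epsilon>" by simp
  have B: "0 \<le> B k" if "k \<in> {1..4}" for k
    using g that by (auto simp: B_def distribution_le_one intro!: prod_nonneg)
  have "B c \<le> T" unfolding T_def using B c by (intro member_le_sum) auto
  then have ratio: "0 \<le> B c / T" "B c / T \<le> 1" using B[OF c] T by auto
  have "A c / S - B c / T = (A c - B c) / S + B c / T * ((T - S) / S)"
    using S T by (simp add: field_simps)
  also have "\<bar>\<dots>\<bar> \<le> \<bar>A c - B c\<bar> / S + B c / T * (\<bar>T - S\<bar> / S)"
    using B[OF c] S T by (intro order_trans[OF abs_triangle_ineq]) (simp add: abs_mult)
  also have "\<dots> \<le> 3 * \<epsilon> + 1 * (12 * \<epsilon>)"
  proof (intro add_mono mult_mono)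
    show "\<bar>A c - B c\<bar> / S \<le> 3 * \<epsilon>"
      using diff[OF c] S by (smt (verit) divide_le_eq_1 divide_less_eq frac_le div_by_1)
    show "\<bar>T - S\<bar> / S \<le> 12 * \<epsilon>"
      using ST S by (smt (verit) divide_le_eq_1 divide_less_eq frac_le div_by_1)
  qed (use ratio S in auto)
  finally show ?thesis by (simp add: A_def B_def S_def T_def)
qed

section \<open>Recursive counting over the children\<close>

context rooted_cubic_tree
begin

text \<open>\<open>F\<close> is the set of vertices whose color is prescribed by \<open>\<tau>\<close>.  In the application it consists of the
  pinned vertices and of all vertices at level \<open>d\<close> or more, and \<open>n\<close> is \<open>d\<close> minus the level of \<open>u\<close>.\<close>

definition extensions :: "'v set \<Rightarrow> ('v \<Rightarrow> nat) \<Rightarrow> nat \<Rightarrow> 'v \<Rightarrow> ('v \<Rightarrow> nat) set" where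
  "extensions F \<tau> n u = {\<xi> \<in> subtree n u \<rightarrow>\<^sub>E {1..4}.
     (\<forall>x y. {x, y} \<in> E \<and> x \<in> subtree n u \<and> y \<in> subtree n u \<longrightarrow> \<xi> x \<noteq> \<xi> y) \<and>
     (\<forall>x\<in>subtree n u \<inter> F. \<xi> x = \<tau> x)}"

lemma finite_extensions: "finite (extensions F \<tau> n u)"
  unfolding extensions_def
  by (rule finite_subset[OF _ finite_PiE[OF finite_subtree[of n u], of "\<lambda>_. {1..4::nat}"]]) auto

lemma restrict_in_extensions:
  assumes "\<tau> \<in> colorings 4 V E" "u \<in> V"
  shows "restrict \<tau> (subtree n u) \<in> extensions F \<tau> n u"
  using assms subtree_in[OF assms(2), of n] by (auto simp: extensions_def colorings_def)

lemma card_extensions_pos: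
  assumes "\<tau> \<in> colorings 4 V E" "u \<in> V"
  shows "0 < card (extensions F \<tau> n u)"
  using restrict_in_extensions[OF assms, of n F] finite_extensions[of F \<tau> n u]
  by (auto simp: card_gt_0_iff)

lemma child_subtree:
  assumes "w \<in> children u" "x \<in> subtree n w"
  shows "x \<in> subtree (Suc n) u" "x \<noteq> u" "(THE w. w \<in> children u \<and> x \<in> subtree n w) = w"
proof -
  show "x \<in> subtree (Suc n) u" using assms by auto
  show "x \<noteq> u" using children_in[OF assms(1)] subtree_level[OF assms(2)] by auto
  show "(THE w. w \<in> children u \<and> x \<in> subtree n w) = w"
    by (rule the_equality) (use assms subtree_disjoint[of x n] children_in in force)+
qed

text \<open>Once \<open>u\<close> has color \<open>c\<close>, the subtrees of the children are
  colored independently, each child only avoiding \<open>c\<close>. The inverse glues the pieces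
  together; it is well defined since these subtrees are disjoint.\<close>

lemma bij_betw_extensions:
  assumes u: "u \<in> V" and c: "c \<in> {1..4}" "u \<in> F \<Longrightarrow> \<tau> u = c"
  shows "bij_betw (\<lambda>\<xi>. \<lambda>w\<in>children u. restrict \<xi> (subtree n w))
    {\<xi> \<in> extensions F \<tau> (Suc n) u. \<xi> u = c} (\<Pi>\<^sub>E w\<in>children u. {\<eta> \<in> extensions F \<tau> n w. \<eta> w \<noteq> c})"
    (is "bij_betw ?f ?A ?B")
proof -
  note subtree.simps(2) [simp del]
  define g where "g h = (\<lambda>x\<in>subtree (Suc n) u.
    if x = u then c else h (THE w. w \<in> children u \<and> x \<in> subtree n w) x)" for h :: "'v \<Rightarrow> 'v \<Rightarrow> nat"
  have subtree_Suc: "x = u \<or> (\<exists>w\<in>children u. x \<in> subtree n w)" if "x \<in> subtree (Suc n) u" for x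
    using that by (simp add: subtree.simps(2))
  have g_child: "g h x = h w x" if "w \<in> children u" "x \<in> subtree n w" for h x w
    using child_subtree[OF that] by (simp add: g_def)
  have g_root: "g h u = c" for h by (simp add: g_def)
  have g_outside: "g h x = undefined" if "x \<notin> subtree (Suc n) u" for h x
    using that by (simp add: g_def)
  have f_in: "?f \<xi> \<in> ?B" if \<xi>: "\<xi> \<in> ?A" for \<xi>
  proof -
    have ext: "\<xi> \<in> extensions F \<tau> (Suc n) u" and "\<xi> u = c" using \<xi> by auto
    have "restrict \<xi> (subtree n w) \<in> {\<eta> \<in> extensions F \<tau> n w. \<eta> w \<noteq> c}" if w: "w \<in> children u" for w
    proof -
      have sub: "x \<in> subtree (Suc n) u" if "x \<in> subtree n w" for x
        using child_subtree(1)[OF w that] .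
      have "{w, u} \<in> E" using w by (simp add: children_def insert_commute)
      moreover have "w \<in> subtree (Suc n) u" using sub self_in_subtree by blast
      ultimately have "\<xi> w \<noteq> \<xi> u"
        using ext self_in_subtree[of u "Suc n"] unfolding extensions_def by blast
      moreover have "restrict \<xi> (subtree n w) \<in> extensions F \<tau> n w"
        using ext sub unfolding extensions_def by (simp add: PiE_iff)
      ultimately show ?thesis using \<open>\<xi> u = c\<close> by simp
    qed
    then show ?thesis by (simp add: PiE_iff)
  qed
  have g_in: "g h \<in> ?A" if h: "h \<in> ?B" for h
  proof -
    have hw: "h w \<in> extensions F \<tau> n w" "h w w \<noteq> c" if "w \<in> children u" for w
      using PiE_mem[OF h that] by auto
    have range: "g h x \<in> {1..4}" if x: "x \<in> subtree (Suc n) u" for x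
    proof (cases "x = u")
      case False
      then obtain w where w: "w \<in> children u" "x \<in> subtree n w" using subtree_Suc[OF x] by blast
      then have "h w x \<in> {1..4}" using hw(1)[OF w(1)] unfolding extensions_def by blast
      then show ?thesis using g_child[OF w] by simp
    qed (use c g_root in simp)
    have proper: "g h x \<noteq> g h y"
      if xy: "{x, y} \<in> E" "x \<in> subtree (Suc n) u" "y \<in> subtree (Suc n) u" for x y
    proof -
      consider "x = u" "y \<in> children u" | "y = u" "x \<in> children u"
        | w where "w \<in> children u" "x \<in> subtree n w" "y \<in> subtree n w"
        using subtree_edge[OF xy] by blast
      then show ?thesis
      proof cases
        case 1
        then show ?thesis
          using g_child[OF 1(2) self_in_subtree, of h] g_root[of h] hw(2)[OF 1(2)] by simp
      next
        case 2
        then show ?thesis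
          using g_child[OF 2(2) self_in_subtree, of h] g_root[of h] hw(2)[OF 2(2)] by simp
      next
        case 3
        then have "h w x \<noteq> h w y" using hw(1)[OF 3(1)] xy(1) unfolding extensions_def by blast
        then show ?thesis using g_child[OF 3(1,2)] g_child[OF 3(1,3)] by simp
      qed
    qed
    have fixed: "g h x = \<tau> x" if x: "x \<in> subtree (Suc n) u" "x \<in> F" for x
    proof (cases "x = u")
      case False
      then obtain w where w: "w \<in> children u" "x \<in> subtree n w" using subtree_Suc[OF x(1)] by blast
      then have "h w x = \<tau> x" using hw(1)[OF w(1)] x(2) unfolding extensions_def by blast
      then show ?thesis using g_child[OF w] by simp
    qed (use c x g_root in simp)
    have "g h \<in> subtree (Suc n) u \<rightarrow>\<^sub>E {1..4}"
      using range g_outside by (intro PiE_I) blast+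
    then have "g h \<in> extensions F \<tau> (Suc n) u"
      using proper fixed unfolding extensions_def by blast
    then show ?thesis using g_root[of h] by blast
  qed
  have gf: "g (?f \<xi>) = \<xi>" if \<xi>: "\<xi> \<in> ?A" for \<xi>
  proof
    fix x
    have PiE: "\<xi> \<in> subtree (Suc n) u \<rightarrow>\<^sub>E {1..4}" using \<xi> unfolding extensions_def by blast
    consider "x \<notin> subtree (Suc n) u" | "x = u" | w where "w \<in> children u" "x \<in> subtree n w"
      using subtree_Suc by blast
    then show "g (?f \<xi>) x = \<xi> x"
    proof cases
      case 1
      then show ?thesis using g_outside PiE_arb[OF PiE] by simp
    next
      case 2
      then show ?thesis using g_root \<xi> by simp
    next
      case 3
      then show ?thesis using g_child[OF 3, of "?f \<xi>"] by simp
    qed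
  qed
  have fg: "?f (g h) = h" if h: "h \<in> ?B" for h
  proof
    fix w
    show "?f (g h) w = h w"
    proof (cases "w \<in> children u")
      case w: True
      have "h w \<in> subtree n w \<rightarrow>\<^sub>E {1..4}" using PiE_mem[OF h w] unfolding extensions_def by blast
      then have "restrict (g h) (subtree n w) x = h w x" for x
        using g_child[OF w, of x h] PiE_arb[of "h w"] by (cases "x \<in> subtree n w") auto
      then show ?thesis using w by (simp add: fun_eq_iff)
    next
      case False
      then show ?thesis using PiE_arb[OF h] by simp
    qed
  qed
  show ?thesis
    by (rule bij_betwI[where g = g]) (use f_in g_in gf fg in blast)+
qed

text \<open>Written with a product over the children because the root has three; at every other free
  vertex it is \<open>combine\<close>. At \<open>n = 0\<close> the vertex lies on the boundary,
  where its color is prescribed.\<close>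

fun message :: "'v set \<Rightarrow> ('v \<Rightarrow> nat) \<Rightarrow> nat \<Rightarrow> 'v \<Rightarrow> nat \<Rightarrow> real" where
  "message F \<tau> 0 u = (\<lambda>c. of_bool (c = \<tau> u))"
| "message F \<tau> (Suc n) u = (if u \<in> F then (\<lambda>c. of_bool (c = \<tau> u)) else
     (\<lambda>c. (\<Prod>w\<in>children u. 1 - message F \<tau> n w c) / (\<Sum>k\<in>{1..4}. \<Prod>w\<in>children u. 1 - message F \<tau> n w k)))"

lemma sum_card_extensions:
  "(\<Sum>c\<in>{1..4}. card {\<xi> \<in> extensions F \<tau> n u. \<xi> u = c}) = card (extensions F \<tau> n u)"
proof -
  have "extensions F \<tau> n u = (\<Union>c\<in>{1..4}. {\<xi> \<in> extensions F \<tau> n u. \<xi> u = c})"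
    by (auto simp: extensions_def PiE_iff)
  then have "card (extensions F \<tau> n u) = card (\<Union>c\<in>{1..4}. {\<xi> \<in> extensions F \<tau> n u. \<xi> u = c})"
    by (rule arg_cong)
  also have "\<dots> = (\<Sum>c\<in>{1..4}. card {\<xi> \<in> extensions F \<tau> n u. \<xi> u = c})"
    by (rule card_UN_disjoint) (auto simp: finite_extensions)
  finally show ?thesis by simp
qed

lemma card_extensions_fixed:
  assumes "u \<in> F"
  shows "card {\<xi> \<in> extensions F \<tau> n u. \<xi> u = c} = card (extensions F \<tau> n u) * of_bool (c = \<tau> u)"
proof -
  have "\<xi> u = \<tau> u" if "\<xi> \<in> extensions F \<tau> n u" for \<xi>
    using that assms by (simp add: extensions_def)
  then have "{\<xi> \<in> extensions F \<tau> n u. \<xi> u = c} = (if c = \<tau> u then extensions F \<tau> n u else {})" by auto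
  then show ?thesis by simp
qed

text \<open>The counts multiply over the children, and the factor \<open>P\<close>, common to all
  colors, cancels in the normalization.\<close>

lemma card_extensions_message:
  assumes \<tau>: "\<tau> \<in> colorings 4 V E" and F: "\<And>x. x \<in> V \<Longrightarrow> d \<le> level x \<Longrightarrow> x \<in> F"
    and "u \<in> V" "level u + n = d" "c \<in> {1..4}"
  shows "real (card {\<xi> \<in> extensions F \<tau> n u. \<xi> u = c}) = card (extensions F \<tau> n u) * message F \<tau> n u c"
  using assms(3-5)
proof (induction n arbitrary: u c)
  case 0
  then show ?case using card_extensions_fixed[of u F \<tau> 0 c] F by simp
next
  case (Suc n)
  show ?case
  proof (cases "u \<in> F")
    case True
    then show ?thesis using card_extensions_fixed[of u F \<tau> "Suc n" c] by simp
  next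
    case False
    define P where "P = (\<Prod>w\<in>children u. real (card (extensions F \<tau> n w)))"
    define Q where "Q k = (\<Prod>w\<in>children u. 1 - message F \<tau> n w k)" for k
    have count: "real (card {\<xi> \<in> extensions F \<tau> (Suc n) u. \<xi> u = k}) = P * Q k" if k: "k \<in> {1..4}" for k
    proof -
      have "card {\<xi> \<in> extensions F \<tau> (Suc n) u. \<xi> u = k}
          = (\<Prod>w\<in>children u. card {\<eta> \<in> extensions F \<tau> n w. \<eta> w \<noteq> k})"
        using bij_betw_same_card[OF bij_betw_extensions[OF Suc.prems(1) k, of F \<tau> n]] False
        by (simp add: card_PiE[OF finite_children])
      also have "real \<dots> = (\<Prod>w\<in>children u. card (extensions F \<tau> n w) * (1 - message F \<tau> n w k))"
        unfolding of_nat_prod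
      proof (rule prod.cong[OF refl])
        fix w assume w: "w \<in> children u"
        have "{\<eta> \<in> extensions F \<tau> n w. \<eta> w \<noteq> k} = extensions F \<tau> n w - {\<eta> \<in> extensions F \<tau> n w. \<eta> w = k}"
          by auto
        moreover have "card {\<eta> \<in> extensions F \<tau> n w. \<eta> w = k} \<le> card (extensions F \<tau> n w)"
          by (rule card_mono) (auto simp: finite_extensions)
        ultimately have "real (card {\<eta> \<in> extensions F \<tau> n w. \<eta> w \<noteq> k})
            = card (extensions F \<tau> n w) - real (card {\<eta> \<in> extensions F \<tau> n w. \<eta> w = k})"
          by (simp add: card_Diff_subset finite_extensions)
        also have "\<dots> = card (extensions F \<tau> n w) * (1 - message F \<tau> n w k)"
          using Suc.IH[of w k] children_in[OF w] Suc.prems(2) k by (simp add: right_diff_distrib)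
        finally show "real (card {\<eta> \<in> extensions F \<tau> n w. \<eta> w \<noteq> k})
          = card (extensions F \<tau> n w) * (1 - message F \<tau> n w k)" .
      qed
      finally show ?thesis by (simp add: P_def Q_def prod.distrib)
    qed
    have "real (card (extensions F \<tau> (Suc n) u)) = (\<Sum>k\<in>{1..4}. real (card {\<xi> \<in> extensions F \<tau> (Suc n) u. \<xi> u = k}))"
      by (simp flip: sum_card_extensions[of F \<tau> "Suc n" u])
    also have "\<dots> = P * (\<Sum>k\<in>{1..4}. Q k)"
      using count by (simp add: sum_distrib_left)
    finally have total: "real (card (extensions F \<tau> (Suc n) u)) = P * (\<Sum>k\<in>{1..4}. Q k)" .
    \<comment> \<open>The coloring \<open>\<tau>\<close> itself restricts to an extension, so the
      total is positive.\<close>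
    then have "(\<Sum>k\<in>{1..4}. Q k) \<noteq> 0"
      using card_extensions_pos[OF \<tau> Suc.prems(1), of F "Suc n"] by auto
    then show ?thesis
      using count[OF Suc.prems(3)] False by (simp add: total Q_def[symmetric])
  qed
qed

lemma distribution_message:
  assumes \<tau>: "\<tau> \<in> colorings 4 V E" and F: "\<And>x. x \<in> V \<Longrightarrow> d \<le> level x \<Longrightarrow> x \<in> F"
    and u: "u \<in> V" "level u + n = d"
  shows "distribution (message F \<tau> n u)"
proof -
  have count: "real (card {\<xi> \<in> extensions F \<tau> n u. \<xi> u = c}) = card (extensions F \<tau> n u) * message F \<tau> n u c"
    if "c \<in> {1..4}" for c
    by (rule card_extensions_message[OF \<tau> _ u that]) (rule F)
  have pos: "0 < real (card (extensions F \<tau> n u))" using card_extensions_pos[OF \<tau> u(1)] by simp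
  have "0 \<le> message F \<tau> n u c" if "c \<in> {1..4}" for c
  proof -
    have "0 \<le> card (extensions F \<tau> n u) * message F \<tau> n u c"
      unfolding count[OF that, symmetric] by simp
    then show ?thesis using pos by (simp add: zero_le_mult_iff)
  qed
  moreover have "card (extensions F \<tau> n u) * (\<Sum>c\<in>{1..4}. message F \<tau> n u c)
      = (\<Sum>c\<in>{1..4}. real (card {\<xi> \<in> extensions F \<tau> n u. \<xi> u = c}))"
    unfolding sum_distrib_left by (rule sum.cong[OF refl]) (simp only: count)
  then have "card (extensions F \<tau> n u) * (\<Sum>c\<in>{1..4}. message F \<tau> n u c) = card (extensions F \<tau> n u)"
    by (simp only: of_nat_sum[symmetric] sum_card_extensions)
  ultimately show ?thesis using pos by (simp add: distribution_def)
qed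

lemma message_pair_message:
  assumes \<tau>: "\<tau> \<in> colorings 4 V E" "\<tau>' \<in> colorings 4 V E"
    and F: "\<And>x. x \<in> V \<Longrightarrow> d \<le> level x \<Longrightarrow> x \<in> F"
    and agree: "\<And>x. x \<in> F \<Longrightarrow> level x < d \<Longrightarrow> \<tau> x = \<tau>' x"
    and "u \<in> V" "u \<noteq> r" "level u + n = d"
  shows "message_pair n (message F \<tau> n u) (message F \<tau>' n u)"
  using assms(5-7)
proof (induction n arbitrary: u)
  case 0
  show ?case
    by (intro message_pair.leaf distribution_message[OF \<tau>(1) F] distribution_message[OF \<tau>(2) F])
      (use 0 in auto)
next
  case (Suc n)
  show ?case
  proof (cases "u \<in> F")
    case True
    then have "message F \<tau> (Suc n) u = message F \<tau>' (Suc n) u"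
      using agree[of u] Suc.prems by simp
    moreover have "distribution (message F \<tau> (Suc n) u)"
      by (rule distribution_message[OF \<tau>(1) F]) (use Suc.prems in auto)
    ultimately show ?thesis by (simp only: message_pair.same)
  next
    case False
    obtain a b where ab: "children u = {a, b}" "a \<noteq> b"
      using card_children[OF Suc.prems(1,2)] by (meson card_2_iff)
    have eq: "message F \<phi> (Suc n) u = combine (message F \<phi> n a) (message F \<phi> n b)" for \<phi>
      using False ab by (simp add: combine_def fun_eq_iff)
    have "message_pair n (message F \<tau> n w) (message F \<tau>' n w)" if w: "w \<in> children u" for w
      using Suc.IH[of w] children_in[OF w] Suc.prems(3) by fastforce
    then show ?thesis unfolding eq using ab by (intro message_pair.step) auto
  qed
qed

text \<open>The children of the root are \<open>n\<close> steps from the boundary at level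
  \<open>Suc n\<close>, so each message changes by at most \<open>5 * \<kappa> ^ n\<close>; the last
  step multiplies this by 15.\<close>

lemma message_root_close:
  assumes \<tau>: "\<tau> \<in> colorings 4 V E" "\<tau>' \<in> colorings 4 V E"
    and F: "\<And>x. x \<in> V \<Longrightarrow> Suc n \<le> level x \<Longrightarrow> x \<in> F" "r \<notin> F"
    and agree: "\<And>x. x \<in> F \<Longrightarrow> level x \<le> n \<Longrightarrow> \<tau> x = \<tau>' x" and c: "c \<in> {1..4}"
  shows "\<bar>message F \<tau> (Suc n) r c - message F \<tau>' (Suc n) r c\<bar> \<le> 75 * \<kappa> ^ n"
proof -
  have child: "w \<in> V" "w \<noteq> r" "level w + n = Suc n" if "w \<in> children r" for w
    using children_in[OF that] by auto
  have close: "\<bar>message F \<tau> n w k - message F \<tau>' n w k\<bar> \<le> 5 * \<kappa> ^ n"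
    if "w \<in> children r" "k \<in> {1..4}" for w k
    by (rule message_pair_decay[OF message_pair_message[OF \<tau> _ _ child[OF that(1)]] that(2)])
      (rule F(1) agree; simp)+
  have dist: "distribution (message F \<phi> n w)" if "w \<in> children r" "\<phi> \<in> colorings 4 V E" for w \<phi>
    by (rule distribution_message[OF that(2) _ child(1,3)[OF that(1)]]) (rule F(1))
  have "\<bar>(\<Prod>w\<in>children r. 1 - message F \<tau> n w c) / (\<Sum>k\<in>{1..4}. \<Prod>w\<in>children r. 1 - message F \<tau> n w k)
    - (\<Prod>w\<in>children r. 1 - message F \<tau>' n w c) / (\<Sum>k\<in>{1..4}. \<Prod>w\<in>children r. 1 - message F \<tau>' n w k)\<bar>
    \<le> 15 * (5 * \<kappa> ^ n)"
    by (rule normalized_product_close[OF card_children_root dist[OF _ \<tau>(1)] dist[OF _ \<tau>(2)] close c])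
  then show ?thesis using F(2) by simp
qed

end

subsection \<open>Conditioned Gibbs measures\<close>

lemma sets_Collect_count_space:
  assumes "f \<in> measurable N (count_space A)"
  shows "{x \<in> space N. f x = c} \<in> sets N"
proof -
  have "f -` ({c} \<inter> A) \<inter> space N \<in> sets N"
    using assms by (rule measurable_sets) simp
  moreover have "f -` ({c} \<inter> A) \<inter> space N = {x \<in> space N. f x = c}"
    using measurable_space[OF assms] by auto
  ultimately show ?thesis by simp
qed

lemma color_measurable:
  assumes "sets \<mu> = sets (coloring_space q V E)" "v \<in> V"
  shows "{\<tau> \<in> space \<mu>. \<tau> v = c} \<in> sets \<mu>"
proof (rule sets_Collect_count_space)
  have "(\<lambda>\<tau>. \<tau> v) \<in> measurable (coloring_space q V E) (count_space {1..q})"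
    unfolding coloring_space_def
    by (rule measurable_restrict_space1, rule measurable_component_singleton) (rule assms(2))
  then show "(\<lambda>\<tau>. \<tau> v) \<in> measurable \<mu> (count_space {1..q})"
    using measurable_cong_sets[OF assms(1) refl] by blast
qed

lemma agreement_in_color_algebra:
  assumes sets: "sets \<mu> = sets (coloring_space q V E)" and U: "countable U" "U \<subseteq> W" "W \<subseteq> V"
  shows "{\<tau> \<in> space \<mu>. \<forall>u\<in>U. \<tau> u = \<sigma> u} \<in> sets (color_algebra q \<mu> W)"
proof -
  let ?N = "\<Pi>\<^sub>M v\<in>W. count_space {1..q}"
  let ?B = "{f \<in> space ?N. \<forall>u\<in>U. f u = \<sigma> u}"
  have "?B \<in> sets ?N"
  proof (cases "U = {}")
    case False
    have "{f \<in> space ?N. f u = \<sigma> u} \<in> sets ?N" if "u \<in> U" for u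
    proof (rule sets_Collect_count_space)
      show "(\<lambda>f. f u) \<in> measurable ?N (count_space {1..q})"
        using that U(2) by (intro measurable_component_singleton) auto
    qed
    then have "(\<Inter>u\<in>U. {f \<in> space ?N. f u = \<sigma> u}) \<in> sets ?N"
      using U(1) False by (intro sets.countable_INT') auto
    moreover have "?B = (\<Inter>u\<in>U. {f \<in> space ?N. f u = \<sigma> u})" using False by auto
    ultimately show ?thesis by simp
  qed simp
  then have "(\<lambda>\<tau>. restrict \<tau> W) -` ?B \<inter> space \<mu> \<in> sets (color_algebra q \<mu> W)"
    unfolding color_algebra_def by (rule in_vimage_algebra)
  moreover have "(\<lambda>\<tau>. restrict \<tau> W) -` ?B \<inter> space \<mu> = {\<tau> \<in> space \<mu>. \<forall>u\<in>U. \<tau> u = \<sigma> u}"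
  proof -
    have "restrict \<tau> W \<in> space ?N" if "\<tau> \<in> space \<mu>" for \<tau>
      using that sets_eq_imp_space_eq[OF sets] U(3)
      by (auto simp: space_coloring_space colorings_def space_PiM)
    then show ?thesis using U(2) by (auto simp: subset_iff)
  qed
  ultimately show ?thesis by simp
qed

text \<open>As \<open>A\<close> depends only on the colors outside \<open>R\<close>, the probability
  of \<open>A\<close> together with color \<open>c\<close> at \<open>v\<close> is the integral over
  \<open>A\<close> of the conditional probability, which is within \<open>\<epsilon>\<close> of
  \<open>b\<close> there.\<close>

lemma measure_color_given_outside:
  assumes cm: "coloring_measure q V E \<mu>" and unif: "uniform_given_outside q V E \<mu> R"
    and R: "finite R" "R \<subseteq> V" "v \<in> R" and A: "A \<in> sets (color_algebra q \<mu> (V - R))"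
    and close: "AE \<tau> in \<mu>. \<tau> \<in> A \<longrightarrow>
      \<bar>(\<Sum>\<xi>\<in>{\<xi> \<in> R \<rightarrow>\<^sub>E {1..q}. \<xi> v = c}. pmf (pmf_of_set (compatible_colorings q V E R \<tau>)) \<xi>) - b\<bar> \<le> \<epsilon>"
  shows "\<bar>measure \<mu> (A \<inter> {\<tau> \<in> space \<mu>. \<tau> v = c}) - b * measure \<mu> A\<bar> \<le> \<epsilon> * measure \<mu> A"
proof -
  let ?F = "color_algebra q \<mu> (V - R)"
  interpret prob_space \<mu> using cm by (simp add: coloring_measure_def)
  have sets: "sets \<mu> = sets (coloring_space q V E)" using cm by (simp add: coloring_measure_def)
  have sub: "subalgebra \<mu> ?F" by (rule subalgebra_color_algebra[OF sets]) auto
  interpret finite_measure_subalgebra \<mu> ?F by unfold_locales (rule sub)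
  have space: "space \<mu> = colorings q V E"
    using sets_eq_imp_space_eq[OF sets] by (simp add: space_coloring_space)
  have A\<mu>: "A \<in> sets \<mu>" using A sub by (auto simp: subalgebra_def)
  define W where "W = {\<xi> \<in> R \<rightarrow>\<^sub>E {1..q}. \<xi> v = c}"
  have W: "finite W"
    unfolding W_def by (rule finite_subset[OF _ finite_PiE[OF R(1), of "\<lambda>_. {1..q}"]]) auto
  define B where "B \<xi> = {\<tau> \<in> space \<mu>. restrict \<tau> R = \<xi>}" for \<xi>
  have B: "B \<xi> \<in> sets \<mu>" if "\<xi> \<in> W" for \<xi>
  proof -
    have "B \<xi> = {\<tau> \<in> space \<mu>. \<forall>x\<in>R. \<tau> x = \<xi> x}"
      using that by (auto simp: B_def W_def fun_eq_iff PiE_def extensional_def)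
    also have "\<dots> \<in> sets \<mu>"
      using R by (intro sets.sets_Collect_finite_All' color_measurable[OF sets]) auto
    finally show ?thesis .
  qed
  define g where "g \<xi> = real_cond_exp \<mu> ?F (indicator (B \<xi>))" for \<xi>
  have int_B: "integrable \<mu> (indicator (B \<xi>) :: _ \<Rightarrow> real)" if "\<xi> \<in> W" for \<xi>
    using B[OF that] by (simp add: less_top[symmetric])
  have g: "integrable \<mu> (g \<xi>)" "(\<integral>\<tau>. indicator A \<tau> * indicator (B \<xi>) \<tau> \<partial>\<mu>) = (\<integral>\<tau>. indicator A \<tau> * g \<xi> \<tau> \<partial>\<mu>)"
    if "\<xi> \<in> W" for \<xi>
    using real_cond_exp_int(1)[OF int_B[OF that]] real_cond_exp_intA[OF int_B[OF that] A]
    by (simp_all add: g_def set_lebesgue_integral_def)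
  have int_Ag: "integrable \<mu> (\<lambda>\<tau>. indicator A \<tau> * g \<xi> \<tau>)" if "\<xi> \<in> W" for \<xi>
    using integrable_mult_indicator[OF A\<mu> g(1)[OF that]] by simp
  have AE_g: "AE \<tau> in \<mu>. \<forall>\<xi>\<in>W. g \<xi> \<tau> = pmf (pmf_of_set (compatible_colorings q V E R \<tau>)) \<xi>"
    using unif W unfolding uniform_given_outside_def g_def B_def
    by (subst AE_finite_all) (auto simp: W_def)
  have split: "indicator (A \<inter> {\<tau> \<in> space \<mu>. \<tau> v = c}) \<tau> = (\<Sum>\<xi>\<in>W. indicator A \<tau> * indicator (B \<xi>) \<tau> :: real)"
    if \<tau>: "\<tau> \<in> space \<mu>" for \<tau>
  proof -
    have "restrict \<tau> R \<in> R \<rightarrow>\<^sub>E {1..q}" using \<tau> R(2) by (auto simp: space colorings_def)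
    then have "restrict \<tau> R \<in> W \<longleftrightarrow> \<tau> v = c" using R(3) by (simp add: W_def)
    moreover have "(\<Sum>\<xi>\<in>W. indicator (B \<xi>) \<tau> :: real) = (\<Sum>\<xi>\<in>W. if restrict \<tau> R = \<xi> then 1 else 0)"
      using \<tau> by (intro sum.cong refl) (simp add: B_def indicator_def)
    ultimately have "(\<Sum>\<xi>\<in>W. indicator (B \<xi>) \<tau> :: real) = of_bool (\<tau> v = c)"
      using W by simp
    then show ?thesis using \<tau> by (simp add: sum_distrib_left[symmetric] indicator_def)
  qed
  have "measure \<mu> (A \<inter> {\<tau> \<in> space \<mu>. \<tau> v = c}) = (\<integral>\<tau>. indicator (A \<inter> {\<tau> \<in> space \<mu>. \<tau> v = c}) \<tau> \<partial>\<mu>)"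
    by (simp add: Int_absorb2 sets.sets_into_space le_infI2)
  also have "\<dots> = (\<integral>\<tau>. (\<Sum>\<xi>\<in>W. indicator A \<tau> * indicator (B \<xi>) \<tau>) \<partial>\<mu>)"
    by (rule Bochner_Integration.integral_cong[OF refl split])
  also have "\<dots> = (\<Sum>\<xi>\<in>W. \<integral>\<tau>. indicator A \<tau> * indicator (B \<xi>) \<tau> \<partial>\<mu>)"
    using integrable_mult_indicator[OF A\<mu> int_B] by (intro Bochner_Integration.integral_sum) simp
  also have "\<dots> = (\<Sum>\<xi>\<in>W. \<integral>\<tau>. indicator A \<tau> * g \<xi> \<tau> \<partial>\<mu>)"
    using g(2) by (rule sum.cong[OF refl])
  also have "\<dots> = (\<integral>\<tau>. (\<Sum>\<xi>\<in>W. indicator A \<tau> * g \<xi> \<tau>) \<partial>\<mu>)"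
    using int_Ag by (rule Bochner_Integration.integral_sum[symmetric])
  finally have eq: "measure \<mu> (A \<inter> {\<tau> \<in> space \<mu>. \<tau> v = c}) = (\<integral>\<tau>. (\<Sum>\<xi>\<in>W. indicator A \<tau> * g \<xi> \<tau>) \<partial>\<mu>)" .
  have int_sum: "integrable \<mu> (\<lambda>\<tau>. \<Sum>\<xi>\<in>W. indicator A \<tau> * g \<xi> \<tau>)"
    using int_Ag by (rule Bochner_Integration.integrable_sum)
  have int_A: "integrable \<mu> (\<lambda>\<tau>. x * indicator A \<tau> :: real)" for x
    using A\<mu> by (simp add: less_top[symmetric])
  have A_meas: "(\<integral>\<tau>. x * indicator A \<tau> \<partial>\<mu>) = x * measure \<mu> A" for x :: real
  proof -
    have "A \<inter> space \<mu> = A" using sets.sets_into_space[OF A\<mu>] by blast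
    then show ?thesis by simp
  qed
  have "measure \<mu> (A \<inter> {\<tau> \<in> space \<mu>. \<tau> v = c}) - b * measure \<mu> A
      = (\<integral>\<tau>. (\<Sum>\<xi>\<in>W. indicator A \<tau> * g \<xi> \<tau>) - b * indicator A \<tau> \<partial>\<mu>)"
    unfolding Bochner_Integration.integral_diff[OF int_sum int_A] A_meas eq by (rule refl)
  also have "\<bar>\<dots>\<bar> \<le> (\<integral>\<tau>. \<bar>(\<Sum>\<xi>\<in>W. indicator A \<tau> * g \<xi> \<tau>) - b * indicator A \<tau>\<bar> \<partial>\<mu>)"
    by (rule integral_abs_bound)
  also have "\<dots> \<le> (\<integral>\<tau>. \<epsilon> * indicator A \<tau> \<partial>\<mu>)"
  proof (rule integral_mono_AE)
    show "AE \<tau> in \<mu>. \<bar>(\<Sum>\<xi>\<in>W. indicator A \<tau> * g \<xi> \<tau>) - b * indicator A \<tau>\<bar> \<le> \<epsilon> * indicator A \<tau>"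
      using close AE_g
    proof eventually_elim
      case (elim \<tau>)
      then show ?case by (cases "\<tau> \<in> A") (simp_all add: W_def[symmetric])
    qed
  qed (intro integrable_abs Bochner_Integration.integrable_diff int_sum int_A)+
  finally show ?thesis by (simp only: A_meas)
qed

section \<open>Conditioned marginals as averages of root messages\<close>

context rooted_cubic_tree
begin

text \<open>The colors at level \<open>d\<close> shield the inside of the ball, so completing a
  coloring outside \<open>R\<close> amounts to extending the prescribed colors to the ball of radius
  \<open>d\<close>, boundary level included.\<close>

lemma sum_pmf_compatible_colorings:
  assumes \<tau>: "\<tau> \<in> colorings 4 V E" and U: "U \<subseteq> V" "r \<notin> U" and d: "0 < d" and c: "c \<in> {1..4}"
    and R: "R = {x \<in> V. level x < d} - U" and F: "F = U \<union> {x. d \<le> level x}"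
  shows "(\<Sum>\<xi>\<in>{\<xi> \<in> R \<rightarrow>\<^sub>E {1..4}. \<xi> r = c}. pmf (pmf_of_set (compatible_colorings 4 V E R \<tau>)) \<xi>)
    = message F \<tau> d r c"
proof -
  let ?T = "subtree d r" and ?C = "compatible_colorings 4 V E R \<tau>"
  have T: "?T = {x \<in> V. level x \<le> d}" by (rule subtree_root)
  have RT: "R \<subseteq> ?T" "R \<subseteq> V" "R \<inter> F = {}" by (auto simp: T R F)
  have TR: "x \<in> R" if "x \<in> ?T" "x \<notin> F" for x using that by (simp add: T R F)
  have finR: "finite R" by (rule finite_subset[OF RT(1) finite_subtree])
  have rR: "r \<in> R" using root U d by (simp add: R)
  have bij: "bij_betw (\<lambda>\<xi>. restrict (override_on \<tau> \<xi> R) ?T) ?C (extensions F \<tau> d r)"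
  proof (rule bij_betwI[where g = "\<lambda>\<eta>. restrict \<eta> R"])
    show "(\<lambda>\<xi>. restrict (override_on \<tau> \<xi> R) ?T) \<in> ?C \<rightarrow> extensions F \<tau> d r"
    proof
      fix \<xi> assume "\<xi> \<in> ?C"
      then have "override_on \<tau> \<xi> R \<in> colorings 4 V E" by (simp add: compatible_colorings_def)
      then have "restrict (override_on \<tau> \<xi> R) ?T \<in> extensions F (override_on \<tau> \<xi> R) d r"
        by (rule restrict_in_extensions[OF _ root])
      moreover have "override_on \<tau> \<xi> R x = \<tau> x" if "x \<in> F" for x
        using that RT(3) by (auto simp: override_on_def)
      ultimately show "restrict (override_on \<tau> \<xi> R) ?T \<in> extensions F \<tau> d r"
        unfolding extensions_def by simp
    qed
    show "(\<lambda>\<eta>. restrict \<eta> R) \<in> extensions F \<tau> d r \<rightarrow> ?C"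
    proof
      fix \<eta> assume \<eta>: "\<eta> \<in> extensions F \<tau> d r"
      let ?o = "override_on \<tau> (restrict \<eta> R) R"
      have range: "\<eta> x \<in> {1..4}" if "x \<in> ?T" for x
        using \<eta> that unfolding extensions_def by blast
      have fixed: "\<eta> x = \<tau> x" if "x \<in> ?T" "x \<in> F" for x
        using \<eta> that unfolding extensions_def by blast
      have o_T: "?o x = \<eta> x" if "x \<in> ?T" for x
        using that TR[OF that] fixed[OF that] RT(3) by (cases "x \<in> F") (auto simp: override_on_def)
      have o_out: "?o x = \<tau> x" if "x \<notin> ?T \<or> x \<in> F" for x
        using that RT by (auto simp: override_on_def)
      have \<tau>V: "\<tau> \<in> V \<rightarrow>\<^sub>E {1..4}" and \<tau>_proper: "\<tau> x \<noteq> \<tau> y" if "{x, y} \<in> E" for x y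
        using \<tau> that unfolding colorings_def by blast+
      \<comment> \<open>An edge that leaves the ball starts at level \<open>d\<close>, hence at a
        prescribed vertex. Thus each edge is proper either by \<open>\<eta>\<close> or by
        \<open>\<tau>\<close>.\<close>
      have boundary: "x \<in> F" if "{x, y} \<in> E" "x \<in> ?T" "y \<notin> ?T" for x y
        using level_edge[OF that(1)] edgeD(2)[OF that(1)] that(2,3) by (simp add: T F)
      have proper: "?o x \<noteq> ?o y" if xy: "{x, y} \<in> E" for x y
      proof -
        have yx: "{y, x} \<in> E" using xy by (simp add: insert_commute)
        consider "x \<in> ?T" "y \<in> ?T" | "x \<notin> ?T \<or> x \<in> F" "y \<notin> ?T \<or> y \<in> F"
          using boundary[OF xy] boundary[OF yx] by blast
        then show ?thesis
        proof cases
          case 1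
          then have "\<eta> x \<noteq> \<eta> y" using \<eta> xy unfolding extensions_def by blast
          then show ?thesis using o_T 1 by simp
        next
          case 2
          then show ?thesis using o_out[of x] o_out[of y] \<tau>_proper[OF xy] by simp
        qed
      qed
      have "?o x \<in> {1..4}" if "x \<in> V" for x
      proof (cases "x \<in> ?T")
        case True
        then show ?thesis using o_T range by simp
      next
        case False
        then have "?o x = \<tau> x" using o_out by blast
        moreover have "\<tau> x \<in> {1..4}" using \<tau> that unfolding colorings_def by blast
        ultimately show ?thesis by simp
      qed
      moreover have "?o x = undefined" if "x \<notin> V" for x
      proof -
        have "?o x = \<tau> x" using that RT(2) by (auto simp: override_on_def)
        moreover have "\<tau> x = undefined" using \<tau> that unfolding colorings_def by (auto intro: PiE_arb)
        ultimately show ?thesis by simp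
      qed
      ultimately have "?o \<in> colorings 4 V E"
        unfolding colorings_def using proper by blast
      moreover have "restrict \<eta> R \<in> R \<rightarrow>\<^sub>E {1..4}" using range RT(1) by auto
      ultimately show "restrict \<eta> R \<in> ?C" by (simp add: compatible_colorings_def)
    qed
    show "restrict (restrict (override_on \<tau> \<xi> R) ?T) R = \<xi>" if "\<xi> \<in> ?C" for \<xi>
    proof
      fix x
      have "\<xi> \<in> R \<rightarrow>\<^sub>E {1..4}" using that by (simp add: compatible_colorings_def)
      then have "\<xi> x = undefined" if "x \<notin> R" using that by (rule PiE_arb)
      then show "restrict (restrict (override_on \<tau> \<xi> R) ?T) R x = \<xi> x" using RT(1) by (cases "x \<in> R") auto
    qed
    show "restrict (override_on \<tau> (restrict \<eta> R) R) ?T = \<eta>" if \<eta>: "\<eta> \<in> extensions F \<tau> d r" for \<eta>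
    proof
      fix x
      have "\<eta> \<in> ?T \<rightarrow>\<^sub>E {1..4}" using \<eta> unfolding extensions_def by blast
      then have "\<eta> x = undefined" if "x \<notin> ?T" using that by (rule PiE_arb)
      moreover have "\<eta> x = \<tau> x" if "x \<in> ?T" "x \<notin> R"
        using \<eta> that TR unfolding extensions_def by blast
      ultimately show "restrict (override_on \<tau> (restrict \<eta> R) R) ?T x = \<eta> x"
        by (auto simp: override_on_def)
    qed
  qed
  have "bij_betw (\<lambda>\<xi>. restrict (override_on \<tau> \<xi> R) ?T) {\<xi> \<in> ?C. \<xi> r = c} {\<xi> \<in> extensions F \<tau> d r. \<xi> r = c}"
    using bij by (rule bij_betw_Collect) (simp add: rR)
  then have card_c: "card {\<xi> \<in> ?C. \<xi> r = c} = card {\<xi> \<in> extensions F \<tau> d r. \<xi> r = c}"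
    by (rule bij_betw_same_card)
  have card_C: "card ?C = card (extensions F \<tau> d r)" using bij by (rule bij_betw_same_card)
  then have pos: "0 < card ?C" using card_extensions_pos[OF \<tau> root] by simp
  then have fin: "finite ?C" "?C \<noteq> {}" using card_gt_0_iff by blast+
  have finW: "finite {\<xi> \<in> R \<rightarrow>\<^sub>E {1..4::nat}. \<xi> r = c}"
    by (rule finite_subset[OF _ finite_PiE[OF finR, of "\<lambda>_. {1..4::nat}"]]) auto
  have C_eq: "{\<xi> \<in> R \<rightarrow>\<^sub>E {1..4}. \<xi> r = c} \<inter> ?C = {\<xi> \<in> ?C. \<xi> r = c}"
    by (auto simp: compatible_colorings_def)
  have "(\<Sum>\<xi>\<in>{\<xi> \<in> R \<rightarrow>\<^sub>E {1..4}. \<xi> r = c}. pmf (pmf_of_set ?C) \<xi>)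
      = (\<Sum>\<xi>\<in>{\<xi> \<in> R \<rightarrow>\<^sub>E {1..4}. \<xi> r = c}. indicator ?C \<xi>) / card ?C"
    using fin by (simp add: sum_divide_distrib)
  also have "\<dots> = card {\<xi> \<in> ?C. \<xi> r = c} / card ?C"
    unfolding indicator_def of_bool_def by (simp only: sum.If_cases[OF finW] Collect_mem_eq C_eq) simp
  also have "\<dots> = message F \<tau> d r c"
  proof -
    have "real (card {\<xi> \<in> extensions F \<tau> d r. \<xi> r = c}) = card (extensions F \<tau> d r) * message F \<tau> d r c"
      by (rule card_extensions_message[OF \<tau> _ root _ c, of d]) (simp_all add: F)
    then show ?thesis using pos by (simp add: card_c card_C)
  qed
  finally show ?thesis .
qed

text \<open>\<open>\<sigma>\<close> serves as a reference boundary condition. Any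
  \<open>\<tau>\<close> agreeing with it on \<open>U\<close> has a root message within
  \<open>75 * \<kappa> ^ n\<close> of that of \<open>\<sigma>\<close>, and so does the average over
  such \<open>\<tau>\<close>.\<close>

lemma marginal_close_to_message:
  assumes p: "infinite_volume_gibbs 4 V E p" and cond: "is_conditioned 4 V E p U \<sigma> \<mu>"
    and \<sigma>: "\<sigma> \<in> colorings 4 V E" and U: "U \<subseteq> V" "r \<notin> U" and c: "c \<in> {1..4}"
  shows "\<bar>marginal \<mu> r c - message (U \<union> {x. Suc n \<le> level x}) \<sigma> (Suc n) r c\<bar> \<le> 75 * \<kappa> ^ n"
proof -
  define F where "F = U \<union> {x. Suc n \<le> level x}"
  define R where "R = {x \<in> V. level x < Suc n} - U"
  define b where "b = message F \<sigma> (Suc n) r c"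
  let ?w = "\<lambda>\<tau>. \<Sum>\<xi>\<in>{\<xi> \<in> R \<rightarrow>\<^sub>E {1..4}. \<xi> r = c}. pmf (pmf_of_set (compatible_colorings 4 V E R \<tau>)) \<xi>"
  have R: "finite R" "R \<subseteq> V" "r \<in> R" "U \<subseteq> V - R"
  proof -
    have "R \<subseteq> subtree n r" by (auto simp: R_def subtree_root)
    then show "finite R" by (rule finite_subset) (rule finite_subtree)
  qed (use root U in \<open>auto simp: R_def\<close>)
  have w: "\<bar>?w \<tau> - b\<bar> \<le> 75 * \<kappa> ^ n" if \<tau>: "\<tau> \<in> colorings 4 V E" and agree: "\<forall>u\<in>U. \<tau> u = \<sigma> u" for \<tau>
  proof -
    have "?w \<tau> = message F \<tau> (Suc n) r c"
      by (rule sum_pmf_compatible_colorings[OF \<tau> U _ c R_def F_def]) simp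
    moreover have "\<bar>message F \<tau> (Suc n) r c - message F \<sigma> (Suc n) r c\<bar> \<le> 75 * \<kappa> ^ n"
      by (rule message_root_close[OF \<tau> \<sigma> _ _ _ c]) (use U agree in \<open>auto simp: F_def\<close>)
    ultimately show ?thesis by (simp add: b_def)
  qed
  let ?A = "{\<tau> \<in> space p. \<forall>u\<in>U. \<tau> u = \<sigma> u}"
  have "\<bar>marginal \<mu> r c - b\<bar> \<le> 75 * \<kappa> ^ n"
  \<comment> \<open>A positive event is averaged over within \<open>p\<close>. In the null case
    \<open>\<mu>\<close> has the required conditional laws itself, and the average runs over its
    whole space.\<close>
  proof (cases "measure p ?A > 0")
    case True
    have cm: "coloring_measure 4 V E p" and unif: "uniform_given_outside 4 V E p R"
      using p R by (auto simp: infinite_volume_gibbs_def)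
    interpret prob_space p using cm by (simp add: coloring_measure_def)
    have sets: "sets p = sets (coloring_space 4 V E)" using cm by (simp add: coloring_measure_def)
    have space: "space p = colorings 4 V E"
      using sets_eq_imp_space_eq[OF sets] by (simp add: space_coloring_space)
    have A: "?A \<in> sets (color_algebra 4 p (V - R))"
      by (rule agreement_in_color_algebra[OF sets])
        (use R U countable_vertices countable_subset in auto)
    have "\<bar>measure p (?A \<inter> {\<tau> \<in> space p. \<tau> r = c}) - b * measure p ?A\<bar> \<le> 75 * \<kappa> ^ n * measure p ?A"
      by (rule measure_color_given_outside[OF cm unif R(1-3) A]) (use w in \<open>auto simp: space\<close>)
    moreover have "marginal \<mu> r c = measure p (?A \<inter> {\<tau> \<in> space p. \<tau> r = c}) / measure p ?A"
    proof -
      have "\<mu> = uniform_measure p ?A" using cond True by (simp add: is_conditioned_def Let_def)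
      moreover have "emeasure p ?A \<noteq> 0" using True by (auto simp: measure_def)
      ultimately show ?thesis
        using measure_uniform_measure[of p ?A, OF _ _ color_measurable[OF sets root]] by (simp add: marginal_def)
    qed
    moreover have "\<bar>m / a - b\<bar> \<le> e" if "\<bar>m - b * a\<bar> \<le> e * a" "0 < a" for m a e :: real
      using that by (simp add: abs_le_iff field_simps)
    ultimately show ?thesis using True by simp
  next
    case False
    then have cm: "coloring_measure 4 V E \<mu>" and agree: "AE \<tau> in \<mu>. \<forall>u\<in>U. \<tau> u = \<sigma> u"
      and "\<forall>R. finite R \<and> R \<subseteq> V - U \<longrightarrow> uniform_given_outside 4 V E \<mu> R"
      using cond by (simp_all add: is_conditioned_def Let_def)
    then have unif: "uniform_given_outside 4 V E \<mu> R" using R by blast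
    interpret prob_space \<mu> using cm by (simp add: coloring_measure_def)
    have sets: "sets \<mu> = sets (coloring_space 4 V E)" using cm by (simp add: coloring_measure_def)
    have space: "space \<mu> = colorings 4 V E"
      using sets_eq_imp_space_eq[OF sets] by (simp add: space_coloring_space)
    have A: "space \<mu> \<in> sets (color_algebra 4 \<mu> (V - R))"
      using sets.top[of "color_algebra 4 \<mu> (V - R)"] by (simp add: color_algebra_def)
    have "\<bar>measure \<mu> (space \<mu> \<inter> {\<tau> \<in> space \<mu>. \<tau> r = c}) - b * measure \<mu> (space \<mu>)\<bar>
        \<le> 75 * \<kappa> ^ n * measure \<mu> (space \<mu>)"
    proof (rule measure_color_given_outside[OF cm unif R(1-3) A])
      show "AE \<tau> in \<mu>. \<tau> \<in> space \<mu> \<longrightarrow> \<bar>?w \<tau> - b\<bar> \<le> 75 * \<kappa> ^ n"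
        using agree by eventually_elim (use w space in blast)
    qed
    moreover have "space \<mu> \<inter> {\<tau> \<in> space \<mu>. \<tau> r = c} = {\<tau> \<in> space \<mu>. \<tau> r = c}" by blast
    ultimately show ?thesis by (simp add: marginal_def prob_space)
  qed
  then show ?thesis by (simp add: b_def F_def)
qed

lemma conditioned_marginals_close:
  assumes p: "infinite_volume_gibbs 4 V E p"
    and cond: "is_conditioned 4 V E p U \<sigma> \<mu>" "is_conditioned 4 V E p U \<phi> \<nu>"
    and col: "\<sigma> \<in> colorings 4 V E" "\<phi> \<in> colorings 4 V E" and U: "U \<subseteq> V" "r \<notin> U"
    and \<Delta>: "{u \<in> U. \<sigma> u \<noteq> \<phi> u} \<noteq> {}"
  shows "(\<Sum>c\<in>{1..4}. \<bar>marginal \<mu> r c - marginal \<nu> r c\<bar>)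
    \<le> 900 / \<kappa> * \<kappa> ^ graph_dist_set E r {u \<in> U. \<sigma> u \<noteq> \<phi> u}"
proof -
  let ?\<Delta> = "{u \<in> U. \<sigma> u \<noteq> \<phi> u}"
  define d where "d = graph_dist_set E r ?\<Delta>"
  have d: "d = Inf (level ` ?\<Delta>)" by (simp add: d_def graph_dist_set_def level_def)
  have "d \<in> level ` ?\<Delta>" unfolding d using \<Delta> by (intro Inf_nat_def1) blast
  then obtain u where "u \<in> U" "d = level u" by blast
  \<comment> \<open>The root is not in \<open>U\<close>. So the ball of radius
    \<open>n = d - 1\<close> contains no disagreement.\<close>
  then have "d \<noteq> 0" using level_eq_0[of u] U by auto
  then obtain n where n: "d = Suc n" by (cases d) auto
  have agree: "\<sigma> x = \<phi> x" if "x \<in> U" "level x \<le> n" for x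
  proof (rule ccontr)
    assume "\<sigma> x \<noteq> \<phi> x"
    then have "d \<le> level x" unfolding d using that by (intro cInf_lower) auto
    then show False using that n by simp
  qed
  let ?F = "U \<union> {x. Suc n \<le> level x}"
  \<comment> \<open>Three comparisons with 75 each: marginal to message, message to message, message
    to marginal. Four colors make 900, and \<open>1 / \<kappa>\<close> pays for passing from
    \<open>n\<close> to \<open>d\<close>.\<close>
  have "\<bar>marginal \<mu> r c - marginal \<nu> r c\<bar> \<le> 225 * \<kappa> ^ n" if c: "c \<in> {1..4}" for c
  proof -
    have "\<bar>message ?F \<sigma> (Suc n) r c - message ?F \<phi> (Suc n) r c\<bar> \<le> 75 * \<kappa> ^ n"
      by (rule message_root_close[OF col _ _ _ c]) (use U agree in auto)
    then show ?thesis
      using marginal_close_to_message[OF p cond(1) col(1) U c, of n]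
        marginal_close_to_message[OF p cond(2) col(2) U c, of n] by linarith
  qed
  then have "(\<Sum>c\<in>{1..4}. \<bar>marginal \<mu> r c - marginal \<nu> r c\<bar>) \<le> (\<Sum>c\<in>{1..4::nat}. 225 * \<kappa> ^ n)"
    by (rule sum_mono)
  also have "\<dots> = 900 / \<kappa> * \<kappa> ^ d" by (simp add: n \<kappa>_def)
  finally show ?thesis by (simp add: d_def)
qed

end

theorem theorem2:
  fixes V :: "'v set" and E :: "'v set set"
  assumes "infinite_regular_tree 3 V E"
  shows "\<exists>C>0. \<exists>a>0. \<forall>p. infinite_volume_gibbs 4 V E p \<longrightarrow>
           strong_spatial_mixing 4 V E p (\<lambda>d. C * exp (- a * real d))"
proof (intro exI conjI allI impI)
  show "0 < 900 / \<kappa>" "0 < - ln \<kappa>" by (auto simp: \<kappa>_def)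
  have decay: "exp (- (- ln \<kappa>) * real d) = \<kappa> ^ d" for d
    using exp_of_nat_mult[of d "ln \<kappa>"] by (simp add: \<kappa>_def mult.commute)
  fix p assume p: "infinite_volume_gibbs 4 V E p"
  show "strong_spatial_mixing 4 V E p (\<lambda>d. 900 / \<kappa> * exp (- (- ln \<kappa>) * real d))"
    unfolding strong_spatial_mixing_def decay
  proof (intro allI impI, elim conjE)
    fix U \<sigma> \<phi> v \<mu> \<nu>
    assume "U \<subseteq> V" "v \<in> V - U" "\<sigma> \<in> colorings 4 V E" "\<phi> \<in> colorings 4 V E"
      "{u \<in> U. \<sigma> u \<noteq> \<phi> u} \<noteq> {}" "is_conditioned 4 V E p U \<sigma> \<mu>" "is_conditioned 4 V E p U \<phi> \<nu>"
    \<comment> \<open>The tree is rooted anew at each \<open>v\<close>; the constants do not depend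
      on the root.\<close>
    moreover have "rooted_cubic_tree V E v"
      using assms calculation(2) by unfold_locales auto
    ultimately show "(\<Sum>c\<in>{1..4}. \<bar>marginal \<mu> v c - marginal \<nu> v c\<bar>)
        \<le> 900 / \<kappa> * \<kappa> ^ graph_dist_set E v {u \<in> U. \<sigma> u \<noteq> \<phi> u}"
      using p by (intro rooted_cubic_tree.conditioned_marginals_close) auto
  qed
qed

end
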